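(* Every free soluble group, i.e. every free group in the variety of soluble groups of given derived length (derived length at most $d$, for a given $d\geq 1$), admits an essentially free (orientation-preserving) affine action on a linear $\Lambda$-tree for some ordered abelian group $\Lambda$; that is, on $\Lambda$ itself.
   Context: An ordered abelian group $\Lambda$ is an additively written abelian group with a translation-invariant linear order; $\mathrm{Aut}^+(\Lambda)$ is the group of order-preserving group automorphisms of $\Lambda$. A linear $\Lambda$-tree means $\Lambda$ itself viewed as a $\Lambda$-metric space via $d(x,y)=|x-y|=\max\{x-y,y-x\}$. Given a group $G$ and a homomorphism $\alpha:G\to\mathrm{Aut}^+(\Lambda)$, $g\mapsto\alpha_g$, an $\alpha$-affine action of $G$ on $\Lambda$ is an action of $G$ on the set $\Lambda$ with $d(gx,gy)=\alpha_g d(x,y)$ for all $x,y\in\Lambda$, $g\in G$. An affine action is an $\alpha$-affine action for some $\alpha$. All affine actions on $\Lambda$ are assumed to be orientation-preserving, i.e. $x\le y\Rightarrow gx\le gy$ (equivalently, each $g$ acts as $x\mapsto \alpha_g x+\nu_g$ for some $\nu_g\in\Lambda$). An orientation-preserving affine automorphism $g$ of $\Lambda$ is hyperbolic if it fixes no point of $\Lambda$, and rigid if no segment $[\lambda_1,\lambda_2]=\{\mu:\lambda_1\le\mu\le\lambda_2\}$ is mapped properly into itself by $g$ or $g^{-1}$; equivalently, if $g^{\epsilon}\lambda>\lambda$ for some $\lambda\in\Lambda$ and $\epsilon=\pm1$, then $g^{\epsilon}\lambda'>\lambda'$ for all $\lambda'\in\Lambda$. An affine action of $G$ on $\Lambda$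 is essentially free if every non-trivial $g\in G$ acts as a rigid and hyperbolic automorphism. *)

theory Defs
  imports "HOL-Algebra.Bij" "HOL-Algebra.Group_Action" "HOL-Algebra.Solvable_Groups"
begin

section \<open>Free soluble groups\<close>

definition soluble_of_length_le :: "nat \<Rightarrow> ('a, 'b) monoid_scheme \<Rightarrow> bool" where
  "soluble_of_length_le d G \<longleftrightarrow> group G \<and> (derived G ^^ d) (carrier G) = {\<one>\<^bsub>G\<^esub>}"

text \<open>Words in letters and formal inverses of letters.\<close>
type_synonym 'a word = "('a \<times> bool) list"

text \<open>
  \<open>G\<close> is free with basis \<open>X\<close> in the variety of soluble groups of derived length at most \<open>d\<close>: the
  usual universal property. HOL cannot quantify over types inside a formula, so the test groups
  \<open>H\<close> range over the groups whose elements have type \<^typ>\<open>'a word set\<close>. This is no restriction: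
  both \<open>G\<close> itself and the quotient of the free group on \<open>X\<close> by the \<open>d\<close>-th term of its derived
  series (whose elements are sets of words over \<open>X\<close>) have copies on that type, so the property
  below already forces \<open>G\<close> to be free with respect to soluble groups on every type.
\<close>
definition free_soluble_on :: "nat \<Rightarrow> ('a, 'b) monoid_scheme \<Rightarrow> 'a set \<Rightarrow> bool" where
  "free_soluble_on d G X \<longleftrightarrow>
     soluble_of_length_le d G \<and> X \<subseteq> carrier G \<and>
     (\<forall>(H :: 'a word set monoid) f.
        soluble_of_length_le d H \<and> f \<in> X \<rightarrow> carrier H \<longrightarrow>
        (\<exists>h \<in> hom G H. (\<forall>x \<in> X. h x = f x) \<and>
           (\<forall>h' \<in> hom G H. (\<forall>x \<in> X. h' x = f x) \<longrightarrow> (\<forall>g \<in> carrier G. h' g = h g))))"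

section \<open>Ordered abelian groups and affine actions\<close>

text \<open>
  The group operation of \<open>\<Lambda>\<close> is written multiplicatively, following \<^locale>\<open>comm_group\<close>; thus
  \<open>x \<otimes> inv y\<close> stands for \<open>x - y\<close> and \<open>(x, y) \<in> r\<close> for \<open>x \<le> y\<close>.
\<close>
locale ordered_abelian_group = comm_group \<Lambda> for \<Lambda> (structure) +
  fixes r :: "('a \<times> 'a) set"
  assumes linear_order: "linear_order_on (carrier \<Lambda>) r"
    and translation_invariant:
      "\<lbrakk>(x, y) \<in> r; z \<in> carrier \<Lambda>\<rbrakk> \<Longrightarrow> (x \<otimes> z, y \<otimes> z) \<in> r"

text \<open>The metric \<open>d(x, y) = max {x - y, y - x}\<close> of \<open>\<Lambda>\<close>, viewed as a linear \<open>\<Lambda>\<close>-tree.\<close>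
definition lin_dist :: "('a, 'b) monoid_scheme \<Rightarrow> 'a rel \<Rightarrow> 'a \<Rightarrow> 'a \<Rightarrow> 'a" where
  "lin_dist \<Lambda> r x y =
     (if (x \<otimes>\<^bsub>\<Lambda>\<^esub> inv\<^bsub>\<Lambda>\<^esub> y, y \<otimes>\<^bsub>\<Lambda>\<^esub> inv\<^bsub>\<Lambda>\<^esub> x) \<in> r
      then y \<otimes>\<^bsub>\<Lambda>\<^esub> inv\<^bsub>\<Lambda>\<^esub> x else x \<otimes>\<^bsub>\<Lambda>\<^esub> inv\<^bsub>\<Lambda>\<^esub> y)"

definition order_preserving :: "'a rel \<Rightarrow> ('a \<Rightarrow> 'a) \<Rightarrow> bool" where
  "order_preserving r f \<longleftrightarrow> (\<forall>(x, y) \<in> r. (f x, f y) \<in> r)"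

definition ordered_aut_group :: "('a, 'b) monoid_scheme \<Rightarrow> 'a rel \<Rightarrow> ('a \<Rightarrow> 'a) monoid" where
  "ordered_aut_group \<Lambda> r =
     AutoGroup \<Lambda> \<lparr>carrier := {f \<in> auto \<Lambda>. order_preserving r f}\<rparr>"

definition alpha_affine_action ::
  "('g, 'm) monoid_scheme \<Rightarrow> ('a, 'b) monoid_scheme \<Rightarrow> 'a rel \<Rightarrow>
     ('g \<Rightarrow> 'a \<Rightarrow> 'a) \<Rightarrow> ('g \<Rightarrow> 'a \<Rightarrow> 'a) \<Rightarrow> bool" where
  "alpha_affine_action G \<Lambda> r \<alpha> \<phi> \<longleftrightarrow>
     \<alpha> \<in> hom G (ordered_aut_group \<Lambda> r) \<and>
     group_action G (carrier \<Lambda>) \<phi> \<and>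
     (\<forall>g \<in> carrier G. \<forall>x \<in> carrier \<Lambda>. \<forall>y \<in> carrier \<Lambda>.
        lin_dist \<Lambda> r (\<phi> g x) (\<phi> g y) = \<alpha> g (lin_dist \<Lambda> r x y))"

definition affine_action ::
  "('g, 'm) monoid_scheme \<Rightarrow> ('a, 'b) monoid_scheme \<Rightarrow> 'a rel \<Rightarrow> ('g \<Rightarrow> 'a \<Rightarrow> 'a) \<Rightarrow> bool" where
  "affine_action G \<Lambda> r \<phi> \<longleftrightarrow> (\<exists>\<alpha>. alpha_affine_action G \<Lambda> r \<alpha> \<phi>)"

definition orientation_preserving_action ::
  "('g, 'm) monoid_scheme \<Rightarrow> 'a rel \<Rightarrow> ('g \<Rightarrow> 'a \<Rightarrow> 'a) \<Rightarrow> bool" where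
  "orientation_preserving_action G r \<phi> \<longleftrightarrow> (\<forall>g \<in> carrier G. order_preserving r (\<phi> g))"

definition hyperbolic :: "('a, 'b) monoid_scheme \<Rightarrow> ('a \<Rightarrow> 'a) \<Rightarrow> bool" where
  "hyperbolic \<Lambda> f \<longleftrightarrow> (\<forall>x \<in> carrier \<Lambda>. f x \<noteq> x)"

definition segment :: "'a rel \<Rightarrow> 'a \<Rightarrow> 'a \<Rightarrow> 'a set" where
  "segment r a b = {m. (a, m) \<in> r \<and> (m, b) \<in> r}"

definition rigid :: "('a, 'b) monoid_scheme \<Rightarrow> 'a rel \<Rightarrow> ('a \<Rightarrow> 'a) \<Rightarrow> bool" where
  "rigid \<Lambda> r f \<longleftrightarrow>
     (\<forall>a \<in> carrier \<Lambda>. \<forall>b \<in> carrier \<Lambda>.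
        \<not> f ` segment r a b \<subset> segment r a b \<and>
        \<not> inv_into (carrier \<Lambda>) f ` segment r a b \<subset> segment r a b)"

definition essentially_free ::
  "('g, 'm) monoid_scheme \<Rightarrow> ('a, 'b) monoid_scheme \<Rightarrow> 'a rel \<Rightarrow> ('g \<Rightarrow> 'a \<Rightarrow> 'a) \<Rightarrow> bool" where
  "essentially_free G \<Lambda> r \<phi> \<longleftrightarrow>
     (\<forall>g \<in> carrier G. g \<noteq> \<one>\<^bsub>G\<^esub> \<longrightarrow> rigid \<Lambda> r (\<phi> g) \<and> hyperbolic \<Lambda> (\<phi> g))"

text \<open>
  The existence of some ordered abelian group has to be stated on a fixed carrier type. The type
  \<open>nat \<times> 'g \<times> 'g word set \<Rightarrow> int\<close> only supplies enough elements: the carrier of \<open>\<Lambda>\<close> is an arbitrary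
  subset of it, and group operation and order are arbitrary. For any affine action of \<open>G\<close> on an
  ordered abelian group, the subgroup generated by the orbit of \<open>0\<close> and closed under all \<open>\<alpha>\<^sub>g\<close> is
  again acted on and has at most \<open>max(|G|, \<aleph>\<^sub>0)\<close> elements, so it has a copy on this type.
\<close>
type_synonym 'g big = "nat \<times> 'g \<times> 'g word set \<Rightarrow> int"

end

theory Submission
  imports Defs "HOL-Algebra.Weak_Morphisms"
begin

text \<open>
  The proof is by the Magnus embedding. Let \<open>F\<^sub>k\<close> be the \<open>k\<close>-th term of the derived series of a free group
  \<open>F\<close>. An element \<open>w\<close> of \<open>F\<close>, read as a path in the Cayley graph of \<open>F / F\<^sub>k\<close>, has a flow: the number of
  times each edge is traversed, counted with sign. Flows are finitely supported functions on the edges,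
  and the edges are permuted freely by \<open>F / F\<^sub>k\<close>, so these functions form a free module over its
  integral group ring. The flow of \<open>w w'\<close> is the flow of \<open>w\<close> plus the translate by \<open>w\<close> of the flow of \<open>w'\<close>.
  Thus \<open>w\<close> acts on this module by the affine map \<open>m \<mapsto> w m + flow w\<close>. An element of \<open>F\<^sub>k\<close> acts as a
  translation, by \<open>0\<close> exactly if it lies in the derived subgroup of \<open>F\<^sub>k\<close>, which is the next term of the
  series; the substantial direction of this is \<open>eval_word_in_derived_of_flow_zero\<close>.

  Now let \<open>\<Lambda>\<close> be the direct sum of these modules for \<open>k < d\<close>. It carries an affine action of \<open>F / F\<^sub>d\<close>, and it
  is ordered lexicographically, with \<open>k = 0\<close> dominating. Within the module of stage \<open>k\<close> a function is
  positive if its value at the largest edge of its support is. For this to be invariant, the order of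
  the edges has to be left invariant, that is, a left-invariant order on \<open>F / F\<^sub>k\<close> is needed. It is
  obtained by induction: \<open>F / F\<^sub>k\<close> acts on the sum of the modules of stages below \<open>k\<close> with trivial
  stabiliser of \<open>0\<close>, so the orbit of \<open>0\<close> orders it (\<open>left_invariant_order_pullback\<close>).

  The action is essentially free. If \<open>w\<close> is nontrivial, let \<open>k\<close> be the first stage where its flow does not
  vanish. Then \<open>w \<in> F\<^sub>k\<close> translates the components of \<open>\<Lambda>\<close> up to stage \<open>k\<close> by one and the same nonzero
  vector. These components dominate, so \<open>w\<close> moves all points in the same direction (\<open>moves_one_way\<close>).

  All groups in this argument are presented by classes of words. A group that is free soluble in the
  sense of the universal property embeds into the concrete one by \<open>free_soluble_embeds\<close>.
\<close>

section \<open>Words and their evaluation in a group\<close>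

definition inv_word :: "'a word \<Rightarrow> 'a word" where
  "inv_word w = rev (map (\<lambda>(x, b). (x, \<not> b)) w)"

lemma inv_word_Nil [simp]: "inv_word [] = []"
  and inv_word_append [simp]: "inv_word (u @ v) = inv_word v @ inv_word u"
  and inv_word_Cons: "inv_word ((x, b) # w) = inv_word w @ [(x, \<not> b)]"
  and inv_word_inv_word [simp]: "inv_word (inv_word w) = w"
  by (auto simp: inv_word_def rev_map comp_def case_prod_unfold)

text \<open>
  The coordinates of the image of a word in the free abelian group on the letters.
\<close>
definition exponent_sum :: "'a word \<Rightarrow> 'a \<Rightarrow> int" where
  "exponent_sum w x = int (count_list w (x, True)) - int (count_list w (x, False))"

lemma exponent_sum_Nil [simp]: "exponent_sum [] x = 0"
  and exponent_sum_append [simp]: "exponent_sum (u @ v) x = exponent_sum u x + exponent_sum v x"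
  and exponent_sum_Cons:
    "exponent_sum ((y, b) # w) x = (if y = x then if b then 1 else -1 else 0) + exponent_sum w x"
  by (auto simp: exponent_sum_def)

lemma exponent_sum_inv_word [simp]: "exponent_sum (inv_word w) x = - exponent_sum w x"
  by (induction w) (auto simp: inv_word_Cons exponent_sum_Cons)

lemma exponent_sum_nonzero_imp_mem: "exponent_sum w x \<noteq> 0 \<Longrightarrow> x \<in> fst ` set w"
  by (induction w) (auto simp: exponent_sum_Cons split: if_splits)

lemma exponent_sum_zero_imp_opposite_mem:
  assumes "exponent_sum ((x, b) # w) = (\<lambda>_. 0)"
  shows "(x, \<not> b) \<in> set w"
proof (rule ccontr)
  assume "(x, \<not> b) \<notin> set w"
  then have "count_list w (x, \<not> b) = 0" by (simp add: count_list_0_iff)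
  then have "if b then exponent_sum w x \<ge> 0 else exponent_sum w x \<le> 0"
    by (cases b) (simp_all add: exponent_sum_def)
  with fun_cong[OF assms, of x] show False
    by (simp add: exponent_sum_Cons split: if_splits)
qed

context group
begin

definition eval_letter :: "('x \<Rightarrow> 'a) \<Rightarrow> 'x \<times> bool \<Rightarrow> 'a" where
  "eval_letter f l = (if snd l then f (fst l) else inv f (fst l))"

primrec eval_word :: "('x \<Rightarrow> 'a) \<Rightarrow> 'x word \<Rightarrow> 'a" where
  "eval_word f [] = \<one>"
| "eval_word f (l # w) = eval_letter f l \<otimes> eval_word f w"

lemma eval_letter_in_subgroup:
  "subgroup N G \<Longrightarrow> range f \<subseteq> N \<Longrightarrow> eval_letter f l \<in> N"
  using subgroup.m_inv_closed[of N G "f (fst l)"] by (auto simp: eval_letter_def)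

lemma eval_word_in_subgroup:
  "subgroup N G \<Longrightarrow> range f \<subseteq> N \<Longrightarrow> eval_word f w \<in> N"
  by (induction w) (auto simp: subgroup.one_closed subgroup.m_closed eval_letter_in_subgroup)

lemmas eval_letter_closed = eval_letter_in_subgroup[OF subgroup_self]
lemmas eval_word_closed = eval_word_in_subgroup[OF subgroup_self]

lemma eval_word_append:
  "range f \<subseteq> carrier G \<Longrightarrow> eval_word f (u @ v) = eval_word f u \<otimes> eval_word f v"
  by (induction u) (auto simp: eval_word_closed eval_letter_closed m_assoc)

lemma eval_word_inv_word:
  assumes "range f \<subseteq> carrier G"
  shows "eval_word f (inv_word w) = inv (eval_word f w)"
proof (induction w)
  case (Cons l w)
  have f: "f (fst l) \<in> carrier G" using assms by auto
  have "eval_word f (inv_word (l # w)) = inv (eval_word f w) \<otimes> inv (eval_letter f l)"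
    using Cons assms f by (cases l) (auto simp: inv_word_Cons eval_word_append eval_letter_def)
  also have "\<dots> = inv (eval_word f (l # w))"
    using assms by (simp add: inv_mult_group eval_word_closed eval_letter_closed)
  finally show ?case .
qed simp

lemma commutator_in_derived:
  "a \<in> H \<Longrightarrow> b \<in> H \<Longrightarrow> a \<otimes> b \<otimes> inv a \<otimes> inv b \<in> derived G H"
  unfolding derived_def by (intro generate.incl) auto

text \<open>
  A word with zero exponent sums cancels completely once the letters are allowed to commute. Working
  inside \<open>N\<close>, the first letter \<open>l\<close> is moved past the subword \<open>u\<close> in front of some inverse of \<open>l\<close>, at the
  price of the commutator of \<open>l\<close> and \<open>u\<close>; the two letters then cancel and a shorter word remains.
\<close>
lemma eval_word_in_derived:
  assumes N: "subgroup N G" and f: "range f \<subseteq> N" and "exponent_sum w = (\<lambda>_. 0)"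
  shows "eval_word f w \<in> derived G N"
  using assms(3)
proof (induction w rule: length_induct)
  case (1 w)
  have NG: "N \<subseteq> carrier G" using N by (rule subgroup.subset)
  have fG: "range f \<subseteq> carrier G" using f NG by blast
  have D: "subgroup (derived G N) G" by (rule derived_is_subgroup[OF NG])
  show ?case
  proof (cases w)
    case Nil
    then show ?thesis using subgroup.one_closed[OF D] by simp
  next
    case (Cons l w')
    obtain x b where l: "l = (x, b)" by (cases l)
    have "(x, \<not> b) \<in> set w'"
      using 1(2) unfolding Cons l by (rule exponent_sum_zero_imp_opposite_mem)
    then obtain u v where w': "w' = u @ (x, \<not> b) # v" by (meson split_list)
    have "exponent_sum (u @ v) = (\<lambda>_. 0)"
      using 1(2) by (simp add: Cons l w' exponent_sum_Cons fun_eq_iff) (smt (verit))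
    then have uv: "eval_word f (u @ v) \<in> derived G N"
      using 1(1) by (auto simp: Cons w')
    have in_N: "eval_letter f l \<in> N" "eval_word f u \<in> N"
      using N f by (auto intro: eval_letter_in_subgroup eval_word_in_subgroup)
    have c: "eval_letter f l \<in> carrier G" "eval_word f u \<in> carrier G" "eval_word f v \<in> carrier G"
      using fG by (auto intro: eval_letter_closed eval_word_closed)
    have "f x \<in> carrier G" using fG by auto
    then have "eval_letter f (x, \<not> b) = inv (eval_letter f l)"
      by (auto simp: eval_letter_def l)
    then have "eval_word f w = eval_letter f l \<otimes> (eval_word f u \<otimes> (inv (eval_letter f l) \<otimes> eval_word f v))"
      using fG by (simp add: Cons w' eval_word_append)
    also have "\<dots> = (eval_letter f l \<otimes> eval_word f u \<otimes> inv (eval_letter f l) \<otimes> inv (eval_word f u)) \<otimes>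
        (eval_word f u \<otimes> eval_word f v)"
      using c by (simp add: m_assoc inv_solve_left) (simp add: m_assoc[symmetric])
    finally show ?thesis
      using subgroup.m_closed[OF D commutator_in_derived[OF in_N] uv] fG
      by (simp add: eval_word_append)
  qed
qed

end

section \<open>Flows of words in Cayley graphs\<close>

text \<open>
  A map \<open>C\<close> satisfying these two axioms presents \<open>range C\<close> as a quotient of the free group on the
  letters: the axioms make concatenation a group operation on \<open>range C\<close>. The free group itself never
  has to be constructed. A word is read as a path from the vertex \<open>C []\<close> in the Cayley graph of the
  quotient, the edge \<open>(x, c)\<close> leading from the vertex \<open>c\<close> along the letter \<open>x\<close>.
\<close>
locale word_quotient =
  fixes C :: "'a word \<Rightarrow> 'c"
  assumes cong: "C u = C u' \<Longrightarrow> C v = C v' \<Longrightarrow> C (u @ v) = C (u' @ v')"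
    and cancel_right: "C (u @ inv_word u) = C []"
begin

lemma cancel_left: "C (inv_word u @ u) = C []"
  using cancel_right[of "inv_word u"] by simp

lemma cancel_mid: "C (p @ u @ inv_word u @ q) = C (p @ q)" "C (p @ inv_word u @ u @ q) = C (p @ q)"
  using cong[OF refl cong[OF cancel_right refl], of p u q]
    cong[OF refl cong[OF cancel_left refl], of p u q] by simp_all

lemma eq_left_translate_iff: "C (u @ q) = C p \<longleftrightarrow> C q = C (inv_word u @ p)"
proof
  assume "C (u @ q) = C p"
  from cong[OF refl this, of "inv_word u"] show "C q = C (inv_word u @ p)"
    using cancel_mid(2)[of "[]" u q] by simp
next
  assume "C q = C (inv_word u @ p)"
  from cong[OF refl this, of u] show "C (u @ q) = C p"
    using cancel_mid(1)[of "[]" u p] by simp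
qed

lemma cong_inv_word:
  assumes "C u = C v" shows "C (inv_word u) = C (inv_word v)"
proof -
  have "C (u @ inv_word v) = C (v @ inv_word v)" by (rule cong[OF assms refl])
  also have "\<dots> = C []" by (rule cancel_right)
  finally show ?thesis using eq_left_translate_iff[of u "inv_word v" "[]"] by simp
qed

abbreviation rep :: "'c \<Rightarrow> 'a word" where "rep \<equiv> inv_into UNIV C"

lemma C_rep [simp]: "c \<in> range C \<Longrightarrow> C (rep c) = c"
  by (rule f_inv_into_f)

lemma C_append_rep [simp]: "C (u @ rep (C v)) = C (u @ v)" "C (rep (C v) @ u) = C (v @ u)"
  by (auto intro!: cong)

definition translate :: "'a word \<Rightarrow> 'c \<Rightarrow> 'c" where
  "translate u c = C (u @ rep c)"

lemma translate_C [simp]: "translate u (C v) = C (u @ v)"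
  by (simp add: translate_def)

lemma translate_in_range [simp]: "translate u c \<in> range C"
  by (simp add: translate_def)

lemma translate_append: "translate (u @ v) c = translate u (translate v c)"
  using C_append_rep(1)[of u "v @ rep c"] by (simp add: translate_def)

lemma translate_inv [simp]:
  "c \<in> range C \<Longrightarrow> translate u (translate (inv_word u) c) = c"
  "c \<in> range C \<Longrightarrow> translate (inv_word u) (translate u c) = c"
  using cancel_mid[of "[]" u] by (auto simp: translate_append[symmetric])

lemma translate_cong: "C u = C v \<Longrightarrow> translate u c = translate v c"
  by (auto simp: translate_def intro: cong)

lemma translate_Nil: "c \<in> range C \<Longrightarrow> C u = C [] \<Longrightarrow> translate u c = c"
  using translate_cong[of u "[]" c] by (auto simp: translate_def)

text \<open>
  The path along \<open>w\<close> starting at \<open>C p\<close>, itself written as a word whose letters are the edges. A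
  formal inverse \<open>(x, False)\<close> traverses an edge backwards, hence the edge that ends where the step
  starts; it is named by the vertex reached after the step.
\<close>
primrec path :: "'a word \<Rightarrow> 'a word \<Rightarrow> ('a \<times> 'c) word" where
  "path p [] = []"
| "path p (l # w) =
     ((fst l, C (if snd l then p else p @ [l])), snd l) # path (p @ [l]) w"

text \<open>
  The net number of times that the path of \<open>w\<close> traverses each edge. These are the Fox derivatives of
  \<open>w\<close>, with coefficients in the group ring of the quotient.
\<close>
abbreviation flow :: "'a word \<Rightarrow> 'a \<times> 'c \<Rightarrow> int" where
  "flow w \<equiv> exponent_sum (path [] w)"

lemma path_append: "path p (u @ v) = path p u @ path (p @ u) v"
  by (induction u arbitrary: p) auto

lemma path_cong:
  assumes "C p = C p'" shows "path p w = path p' w"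
  using assms
proof (induction w arbitrary: p p')
  case (Cons l w)
  have l: "C (p @ [l]) = C (p' @ [l])" by (rule cong[OF Cons.prems refl])
  from Cons.IH[OF l] l Cons.prems show ?case by simp
qed simp

lemma path_inv_word: "path (p @ w) (inv_word w) = inv_word (path p w)"
proof (induction w arbitrary: p)
  case (Cons l w)
  obtain x b where l: "l = (x, b)" by (cases l)
  have "C (p @ l # w @ inv_word w) = C (p @ [l])"
    using cancel_mid(1)[of "p @ [l]" w "[]"] by simp
  moreover have "C (p @ l # w @ inv_word w @ [(x, \<not> b)]) = C p"
    using cancel_mid(1)[of p "l # w" "[]"] by (simp add: inv_word_Cons l)
  ultimately show ?case
    using Cons[of "p @ [l]"] by (auto simp: inv_word_Cons path_append l)
qed simp

lemma path_snd_in_range: "e \<in> fst ` set (path p w) \<Longrightarrow> snd e \<in> range C"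
  by (induction w arbitrary: p) auto

lemma flow_outside:
  assumes "c \<notin> range C" shows "exponent_sum (path p w) (x, c) = 0"
  using assms exponent_sum_nonzero_imp_mem[of "path p w" "(x, c)"] path_snd_in_range[of "(x, c)" p w]
  by auto

lemma finite_flow: "finite {e. flow w e \<noteq> 0}"
  by (rule finite_subset[of _ "fst ` set (path [] w)"])
    (auto dest!: exponent_sum_nonzero_imp_mem simp: image_iff)

lemma exponent_sum_path_translate:
  "exponent_sum (path (u @ q) w) (x, C p) = exponent_sum (path q w) (x, C (inv_word u @ p))"
proof (induction w arbitrary: q)
  case (Cons l w)
  show ?case
    using Cons[of "q @ [l]"] eq_left_translate_iff[of u "q @ [l]" p] eq_left_translate_iff[of u q p]
    by (simp add: exponent_sum_Cons)
qed simp

text \<open>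
  The rule for Fox derivatives of a product: the second half of the path is the path of \<open>v\<close>,
  translated by \<open>u\<close>.
\<close>
lemma flow_append:
  "flow (u @ v) (x, C p) = flow u (x, C p) + flow v (x, C (inv_word u @ p))"
  using exponent_sum_path_translate[of u "[]" v] by (simp add: path_append)

lemma flow_append_kernel:
  assumes "C u = C []" shows "flow (u @ v) = (\<lambda>e. flow u e + flow v e)"
  using path_cong[OF assms] by (simp add: path_append fun_eq_iff)

lemma flow_inv_word_kernel:
  assumes "C u = C []" shows "flow (inv_word u) = (\<lambda>e. - flow u e)"
  using path_cong[OF assms, of "inv_word u"] path_inv_word[of "[]" u] by (simp add: fun_eq_iff)

text \<open>
  Adding the flow as an invariant again gives a quotient of the free group, because the flow of a
  product is determined by the classes and flows of its factors.
\<close>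
lemma flow_quotient:
  assumes C': "\<And>u v. C' u = C' v \<longleftrightarrow> C u = C v \<and> flow u = flow v"
  shows "word_quotient C'"
proof
  fix u u' v v' assume u: "C' u = C' u'" and v: "C' v = C' v'"
  have "flow (u @ v) (x, c) = flow (u @ v') (x, c)" for x c
  proof (cases "c \<in> range C")
    case True
    then obtain p where "c = C p" by auto
    then show ?thesis using v by (simp add: C' flow_append)
  qed (simp add: flow_outside)
  moreover have "flow (u @ v') = flow (u' @ v')"
    using u path_cong[of u u' v'] by (simp add: C' path_append fun_eq_iff)
  ultimately have "flow (u @ v) = flow (u' @ v')" by auto
  moreover have "C (u @ v) = C (u' @ v')" using u v by (auto simp: C' intro: cong)
  ultimately show "C' (u @ v) = C' (u' @ v')" by (simp add: C')
next
  fix u show "C' (u @ inv_word u) = C' []"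
    using path_inv_word[of "[]" u] by (auto simp: C' path_append cancel_right)
qed

end

text \<open>
  The core of the Magnus embedding theorem. Choose a representative word for every vertex of the
  Cayley graph. An edge, completed to a loop by the representatives of its end points, evaluates to
  an element \<open>c\<close> of \<open>N\<close>, and the evaluation of \<open>w\<close> telescopes into the product of the elements \<open>c\<close> of the
  edges on its path. If the flow is zero, this is a word in elements of \<open>N\<close> with zero exponent sums,
  so \<open>eval_word_in_derived\<close> applies.
\<close>
lemma (in group) eval_word_in_derived_of_flow_zero:
  assumes "word_quotient C" and f: "range f \<subseteq> carrier G" and N: "subgroup N G"
    and kernel: "\<And>w. C w = C [] \<Longrightarrow> eval_word f w \<in> N"
    and w: "C w = C []" and flow_zero: "exponent_sum (word_quotient.path C [] w) = (\<lambda>_. 0)"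
  shows "eval_word f w \<in> derived G N"
proof -
  interpret word_quotient C by fact
  let ?\<rho> = "\<lambda>p. eval_word f (rep (C p))"
  define c where
    "c = (\<lambda>(x, q). eval_word f (rep q) \<otimes> f x \<otimes> inv (eval_word f (rep (C (rep q @ [(x, True)])))))"
  have fx [simp]: "f x \<in> carrier G" for x using f by auto
  have ev [simp]: "eval_word f v \<in> carrier G" for v using f by (rule eval_word_closed)
  have letter: "eval_letter f l \<in> carrier G" for l using f by (rule eval_letter_closed)
  have c_N: "c (x, q) \<in> N" for x q
  proof -
    let ?v = "rep (C (rep q @ [(x, True)]))"
    have "C ((rep q @ [(x, True)]) @ inv_word ?v) = C (?v @ inv_word ?v)"
      by (rule cong) simp_all
    also have "\<dots> = C []" by (rule cancel_right)
    finally have "eval_word f ((rep q @ [(x, True)]) @ inv_word ?v) \<in> N"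
      by (rule kernel)
    then show ?thesis
      using f by (simp add: c_def eval_word_append eval_word_inv_word eval_letter_def m_assoc)
  qed
  have c_G: "range c \<subseteq> carrier G" using c_N subgroup.subset[OF N] by auto
  \<comment> \<open>A step against an edge contributes the inverse of the element of that edge.\<close>
  have step: "?\<rho> p \<otimes> eval_letter f l \<otimes> inv (?\<rho> (p @ [l])) =
      eval_letter c ((fst l, C (if snd l then p else p @ [l])), snd l)" for p l
  proof (cases l)
    case (Pair x b)
    show ?thesis
    proof (cases b)
      case True
      then show ?thesis using Pair by (simp add: eval_letter_def c_def)
    next
      case False
      have "C (rep (C (p @ [l])) @ [(x, True)]) = C p"
        using cancel_mid(1)[of p "[l]" "[]"] by (simp add: inv_word_Cons Pair False)
      then show ?thesis using Pair False by (simp add: eval_letter_def c_def inv_mult_group m_assoc)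
    qed
  qed
  have telescope: "?\<rho> p \<otimes> eval_word f v \<otimes> inv (?\<rho> (p @ v)) = eval_word c (path p v)" for p v
  proof (induction v arbitrary: p)
    case Nil
    then show ?case by simp
  next
    case (Cons l v)
    have "?\<rho> p \<otimes> eval_word f (l # v) \<otimes> inv (?\<rho> (p @ l # v)) =
        (?\<rho> p \<otimes> eval_letter f l \<otimes> inv (?\<rho> (p @ [l]))) \<otimes>
        (?\<rho> (p @ [l]) \<otimes> eval_word f v \<otimes> inv (?\<rho> (p @ l # v)))"
      using letter[of l] by (simp add: m_assoc inv_solve_left)
    also have "\<dots> = eval_word c (path p (l # v))"
      using Cons[of "p @ [l]"] unfolding step by simp
    finally show ?case .
  qed
  define a where "a = ?\<rho> []"
  have NG: "N \<subseteq> carrier G" by (rule subgroup.subset[OF N])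
  have D: "subgroup (derived G N) G" by (rule derived_is_subgroup[OF NG])
  have "eval_word c (path [] w) \<in> derived G N"
    by (rule eval_word_in_derived[OF N _ flow_zero]) (use c_N in auto)
  then have conj: "a \<otimes> eval_word f w \<otimes> inv a \<in> derived G N"
    using telescope[of "[]" w] w by (simp add: a_def)
  have a: "a \<in> N" unfolding a_def by (rule kernel) simp
  have aG: "a \<in> carrier G" by (simp add: a_def)
  \<comment> \<open>The telescoped product is a conjugate of the value of w by an element a of N, and conjugating
    changes an element of N only by a commutator of elements of N.\<close>
  have "eval_word f w = (eval_word f w \<otimes> a \<otimes> inv (eval_word f w) \<otimes> inv a) \<otimes>
      (a \<otimes> eval_word f w \<otimes> inv a)"
    using aG by (simp add: m_assoc inv_solve_left) (simp add: m_assoc[symmetric])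
  moreover have "eval_word f w \<otimes> a \<otimes> inv (eval_word f w) \<otimes> inv a \<in> derived G N"
    using commutator_in_derived[OF kernel[OF w] a] .
  ultimately show ?thesis using subgroup.m_closed[OF D _ conj] by metis
qed

section \<open>The tower of quotients\<close>

text \<open>
  The group presented by \<open>C\<close>, on the type of its values.
\<close>
context word_quotient
begin

definition quotient_group :: "'c monoid" where
  "quotient_group = \<lparr>carrier = range C, mult = \<lambda>c c'. C (rep c @ rep c'), one = C []\<rparr>"

lemma carrier_quotient_group [simp]: "carrier quotient_group = range C"
  and one_quotient_group [simp]: "\<one>\<^bsub>quotient_group\<^esub> = C []"
  by (simp_all add: quotient_group_def)

lemma mult_quotient_group [simp]: "C u \<otimes>\<^bsub>quotient_group\<^esub> C v = C (u @ v)"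
  using cong[of "rep (C u)" u "rep (C v)" v] by (simp add: quotient_group_def)

lemma group_quotient_group: "group quotient_group"
proof (rule groupI)
  fix c assume "c \<in> carrier quotient_group"
  then obtain u where "c = C u" by auto
  then show "\<exists>c'\<in>carrier quotient_group. c' \<otimes>\<^bsub>quotient_group\<^esub> c = \<one>\<^bsub>quotient_group\<^esub>"
    by (intro bexI[of _ "C (inv_word u)"]) (auto simp: cancel_left)
qed auto

lemma inv_quotient_group [simp]: "inv\<^bsub>quotient_group\<^esub> C u = C (inv_word u)"
  using group.inv_equality[OF group_quotient_group, of "C (inv_word u)" "C u"]
  by (simp add: cancel_left)

end

text \<open>
  The class of a word in the free soluble group of derived length \<open>k\<close> on all letters: a word is
  trivial at stage \<open>k + 1\<close> if it is trivial at stage \<open>k\<close> and has zero flow in the Cayley graph of stage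
  \<open>k\<close>. Classes are sets of words, so that they can serve both as group elements and as vertices.
\<close>
primrec soluble_class :: "nat \<Rightarrow> 'a word \<Rightarrow> 'a word set" where
  "soluble_class 0 w = UNIV"
| "soluble_class (Suc k) w =
     {v. soluble_class k v = soluble_class k w \<and>
         exponent_sum (word_quotient.path (soluble_class k) [] v) =
         exponent_sum (word_quotient.path (soluble_class k) [] w)}"

lemma soluble_class_Suc_eq_iff:
  "soluble_class (Suc k) u = soluble_class (Suc k) v \<longleftrightarrow>
     soluble_class k u = soluble_class k v \<and>
     exponent_sum (word_quotient.path (soluble_class k) [] u) =
     exponent_sum (word_quotient.path (soluble_class k) [] v)"
  by auto

lemma word_quotient_soluble_class: "word_quotient (soluble_class k)"
proof (induction k)
  case 0
  show ?case by standard simp_all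
next
  case (Suc k)
  show ?case by (rule word_quotient.flow_quotient[OF Suc soluble_class_Suc_eq_iff])
qed

interpretation tower: word_quotient "soluble_class k" for k
  by (rule word_quotient_soluble_class)

lemma soluble_class_eq_iff:
  "soluble_class k u = soluble_class k v \<longleftrightarrow> (\<forall>j<k. tower.flow j u = tower.flow j v)"
  by (induction k) (auto simp: soluble_class_Suc_eq_iff less_Suc_eq simp del: soluble_class.simps(2))

lemma soluble_class_mono:
  "soluble_class k u = soluble_class k v \<Longrightarrow> j \<le> k \<Longrightarrow> soluble_class j u = soluble_class j v"
  by (auto simp: soluble_class_eq_iff)

text \<open>
  On words that are trivial at stage \<open>k\<close> the flow at stage \<open>k\<close> is additive, so commutators of such words
  have zero flow and are trivial at stage \<open>k + 1\<close>.
\<close>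
lemma derived_quotient_group_subset:
  "(derived (tower.quotient_group d :: 'a word set monoid) ^^ k) (carrier (tower.quotient_group d))
     \<subseteq> {soluble_class d w | w. soluble_class k w = soluble_class k []}"
proof (induction k)
  case 0
  then show ?case by auto
next
  case (Suc k)
  let ?H = "tower.quotient_group d :: 'a word set monoid"
  interpret H: group ?H by (rule tower.group_quotient_group)
  let ?K = "\<lambda>k. {soluble_class d w | w :: 'a word. soluble_class k w = soluble_class k []}"
  have kernel_iff: "soluble_class (Suc k) w = soluble_class (Suc k) [] \<longleftrightarrow>
      soluble_class k w = soluble_class k [] \<and> tower.flow k w = (\<lambda>_. 0)" for w :: "'a word"
    by (auto simp: soluble_class_Suc_eq_iff fun_eq_iff simp del: soluble_class.simps(2))
  have kernel_append: "soluble_class k (u @ v) = soluble_class k []"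
    if "soluble_class k u = soluble_class k []" "soluble_class k v = soluble_class k []"
    for u v :: "'a word"
    using tower.cong[OF that] by simp
  have kernel_inv: "soluble_class k (inv_word u) = soluble_class k []"
    if "soluble_class k u = soluble_class k []" for u :: "'a word"
    using tower.cong_inv_word[OF that] by simp
  note kernel = tower.flow_append_kernel[OF] tower.flow_inv_word_kernel kernel_append kernel_inv
  have sub: "subgroup (?K (Suc k)) ?H"
  proof (rule subgroup.intro)
    fix a b assume "a \<in> ?K (Suc k)" "b \<in> ?K (Suc k)"
    then obtain u v where
      uv: "a = soluble_class d u" "b = soluble_class d v"
        "soluble_class (Suc k) u = soluble_class (Suc k) []"
        "soluble_class (Suc k) v = soluble_class (Suc k) []"
      by blast
    then have "soluble_class (Suc k) (u @ v) = soluble_class (Suc k) []"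
      by (simp add: kernel_iff kernel del: soluble_class.simps(2))
    then show "a \<otimes>\<^bsub>?H\<^esub> b \<in> ?K (Suc k)" using uv(1,2) by auto
  next
    fix a assume "a \<in> ?K (Suc k)"
    then obtain u where
      u: "a = soluble_class d u" "soluble_class (Suc k) u = soluble_class (Suc k) []"
      by blast
    then have "soluble_class (Suc k) (inv_word u) = soluble_class (Suc k) []"
      by (simp add: kernel_iff kernel del: soluble_class.simps(2))
    then show "inv\<^bsub>?H\<^esub> a \<in> ?K (Suc k)" using u(1) by auto
  qed auto
  have "derived_set ?H (?K k) \<subseteq> ?K (Suc k)"
  proof
    fix z assume "z \<in> derived_set ?H (?K k)"
    then obtain u v where z: "z = soluble_class d (u @ v @ inv_word u @ inv_word v)"
      and uv: "soluble_class k u = soluble_class k []" "soluble_class k v = soluble_class k []"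
      by auto
    from uv have "soluble_class (Suc k) (u @ v @ inv_word u @ inv_word v) = soluble_class (Suc k) []"
      by (simp add: kernel_iff kernel del: soluble_class.simps(2))
    then show "z \<in> ?K (Suc k)" using z by auto
  qed
  then have "derived ?H (?K k) \<subseteq> ?K (Suc k)"
    unfolding derived_def by (rule H.generate_subgroup_incl[OF _ sub])
  with H.mono_derived[OF Suc] show ?case by auto
qed

lemma soluble_quotient_group: "soluble_of_length_le d (tower.quotient_group d)"
proof -
  interpret H: group "tower.quotient_group d" by (rule tower.group_quotient_group)
  have "soluble_class d [] \<in> (derived (tower.quotient_group d) ^^ d) (carrier (tower.quotient_group d))"
    using subgroup.one_closed[OF H.exp_of_derived_is_subgroup[OF H.subgroup_self]] by simp
  with derived_quotient_group_subset[of d d] show ?thesis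
    using H.group_axioms unfolding soluble_of_length_le_def by auto
qed

text \<open>
  The converse direction: the tower has no relations beyond those of solubility. Each stage is one
  application of the Magnus argument.
\<close>
lemma (in group) eval_word_in_exp_of_derived:
  assumes f: "range f \<subseteq> carrier G" and "soluble_class k w = soluble_class k []"
  shows "eval_word f w \<in> (derived G ^^ k) (carrier G)"
  using assms(2)
proof (induction k arbitrary: w)
  case 0
  then show ?case using f by (simp add: eval_word_closed)
next
  case (Suc k)
  have w: "soluble_class k w = soluble_class k []" and flow: "tower.flow k w = (\<lambda>_. 0)"
    using Suc.prems by (auto simp: soluble_class_Suc_eq_iff fun_eq_iff simp del: soluble_class.simps(2))
  have "subgroup ((derived G ^^ k) (carrier G)) G"
    by (rule exp_of_derived_is_subgroup[OF subgroup_self])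
  from eval_word_in_derived_of_flow_zero[OF word_quotient_soluble_class f this Suc.IH w flow]
  show ?case by simp
qed

lemma (in group) eval_word_cong:
  assumes f: "range f \<subseteq> carrier G" and G: "soluble_of_length_le d G"
    and uv: "soluble_class d u = soluble_class d v"
  shows "eval_word f u = eval_word f v"
proof -
  have "soluble_class d (u @ inv_word v) = soluble_class d []"
    using tower.cong[OF uv refl, of "inv_word v"] by (simp add: tower.cancel_right)
  from eval_word_in_exp_of_derived[OF f this] have "eval_word f (u @ inv_word v) = \<one>"
    using G by (simp add: soluble_of_length_le_def)
  then show ?thesis
    using f by (simp add: eval_word_append eval_word_inv_word eval_word_closed inv_solve_right')
qed

section \<open>Free soluble groups embed into the tower\<close>

lemma (in group) inj_imp_image_group:
  assumes "inj_on j (carrier G)"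
  shows "group (image_group j G)" "j \<in> hom G (image_group j G)"
proof -
  have "weak_group_morphism j {\<one>} G"
  proof (rule weak_group_morphismsI[OF one_is_normal])
    fix a b assume ab: "a \<in> carrier G" "b \<in> carrier G"
    then have "j a = j b \<longleftrightarrow> a = b" using assms by (auto dest: inj_onD)
    also have "\<dots> \<longleftrightarrow> a \<otimes> inv b \<in> {\<one>}" using ab by (simp add: inv_solve_right')
    finally show "j a = j b \<longleftrightarrow> a \<otimes> inv b \<in> {\<one>}" .
  qed
  then show "group (image_group j G)" "j \<in> hom G (image_group j G)"
    by (rule image_group_is_group, rule weak_group_morphism_is_hom)
qed

lemma soluble_of_length_le_image_group:
  assumes "soluble_of_length_le d G" and "inj_on j (carrier G)"
  shows "soluble_of_length_le d (image_group j G)"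
proof -
  interpret group G using assms(1) by (simp add: soluble_of_length_le_def)
  interpret j: group_hom G "image_group j G" j
    using inj_imp_image_group[OF assms(2)]
    by (simp add: group_hom_def group_hom_axioms_def group_axioms)
  have "(derived (image_group j G) ^^ d) (carrier (image_group j G)) = j ` (derived G ^^ d) (carrier G)"
    using j.exp_of_derived_img[of "carrier G" d] by (simp add: image_group_carrier)
  then show ?thesis
    using assms(1) j.group_axioms inj_imp_image_group(1)[OF assms(2)]
    by (simp add: soluble_of_length_le_def)
qed

text \<open>
  The universal property gives \<open>h\<close> into the tower; evaluating representative words in \<open>G\<close> gives a map
  back. Their composite fixes the basis, so it is the identity by the uniqueness part of the universal
  property, applied to a copy of \<open>G\<close> on the type of sets of words. Hence \<open>h\<close> is injective.
\<close>
lemma free_soluble_embeds: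
  fixes G :: "('g, 'm) monoid_scheme" (structure)
  assumes free: "free_soluble_on d G X"
  obtains h where "h \<in> hom G (tower.quotient_group d :: 'g word set monoid)"
    and "inj_on h (carrier G)"
proof -
  let ?H = "tower.quotient_group d :: 'g word set monoid"
  have sol: "soluble_of_length_le d G" and X: "X \<subseteq> carrier G"
    using free by (auto simp: free_soluble_on_def)
  have universal: "\<exists>h\<in>hom G H. (\<forall>x\<in>X. h x = f x) \<and>
      (\<forall>h'\<in>hom G H. (\<forall>x\<in>X. h' x = f x) \<longrightarrow> (\<forall>g\<in>carrier G. h' g = h g))"
    if "soluble_of_length_le d H" "f \<in> X \<rightarrow> carrier H" for H :: "'g word set monoid" and f
    using free that unfolding free_soluble_on_def by blast
  interpret group G using sol by (simp add: soluble_of_length_le_def)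
  interpret H: group ?H by (rule tower.group_quotient_group)
  \<comment> \<open>Words use all elements of the type as letters; those outside the basis are evaluated trivially.\<close>
  define f where "f = (\<lambda>x. if x \<in> X then x else \<one>)"
  have f: "range f \<subseteq> carrier G" using X by (auto simp: f_def)
  define j :: "'g \<Rightarrow> 'g word set" where "j = (\<lambda>g. {[(g, True)]})"
  have j: "inj_on j (carrier G)" by (auto simp: j_def inj_on_def)
  note J = inj_imp_image_group[OF j]
  obtain h where h: "h \<in> hom G ?H" and hX: "\<And>x. x \<in> X \<Longrightarrow> h x = soluble_class d [(x, True)]"
    using universal[OF soluble_quotient_group, of "\<lambda>x. soluble_class d [(x, True)]"] by auto
  define e where "e = (\<lambda>g. eval_word f (tower.rep d (h g)))"
  have hG: "h g \<in> range (soluble_class d)" if "g \<in> carrier G" for g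
    using hom_in_carrier[OF h that] by simp
  have e: "e \<in> hom G G"
  proof (rule homI)
    fix g g' assume g: "g \<in> carrier G" "g' \<in> carrier G"
    have "soluble_class d (tower.rep d (h (g \<otimes> g'))) = h g \<otimes>\<^bsub>?H\<^esub> h g'"
      using hG[OF m_closed[OF g]] hom_mult[OF h g] by simp
    also have "\<dots> = soluble_class d (tower.rep d (h g) @ tower.rep d (h g'))"
      using tower.mult_quotient_group[of d "tower.rep d (h g)" "tower.rep d (h g')"]
      by (simp only: tower.C_rep[OF hG[OF g(1)]] tower.C_rep[OF hG[OF g(2)]])
    finally have "soluble_class d (tower.rep d (h (g \<otimes> g'))) =
        soluble_class d (tower.rep d (h g) @ tower.rep d (h g'))" .
    from eval_word_cong[OF f sol this] show "e (g \<otimes> g') = e g \<otimes> e g'"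
      by (simp add: e_def eval_word_append f)
  qed (simp add: e_def eval_word_closed f)
  have eX: "e x = x" if "x \<in> X" for x
  proof -
    have "soluble_class d (tower.rep d (h x)) = soluble_class d [(x, True)]"
      using hX[OF that] by simp
    from eval_word_cong[OF f sol this] show ?thesis
      using that X by (auto simp: e_def f_def eval_letter_def)
  qed
  have "j \<in> X \<rightarrow> carrier (image_group j G)" using X by (auto simp: image_group_carrier)
  from universal[OF soluble_of_length_le_image_group[OF sol j] this]
  obtain k where k: "\<forall>h'\<in>hom G (image_group j G).
      (\<forall>x\<in>X. h' x = j x) \<longrightarrow> (\<forall>g\<in>carrier G. h' g = k g)"
    by blast
  have "j \<circ> e \<in> hom G (image_group j G)" by (rule Group.hom_compose[OF e J(2)])
  moreover have "\<forall>x\<in>X. (j \<circ> e) x = j x" using eX by simp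
  ultimately have "\<forall>g\<in>carrier G. (j \<circ> e) g = k g" using k by blast
  moreover have "\<forall>g\<in>carrier G. j g = k g" using k J(2) by blast
  ultimately have "j (e g) = j g" if "g \<in> carrier G" for g using that by simp
  then have e_id: "e g = g" if "g \<in> carrier G" for g using that by (simp add: j_def)
  have "inj_on h (carrier G)"
  proof (rule inj_onI)
    fix g g' assume g: "g \<in> carrier G" "g' \<in> carrier G" and "h g = h g'"
    then have "e g = e g'" by (simp add: e_def)
    then show "g = g'" by (simp only: e_id g)
  qed
  with h show ?thesis by (rule that)
qed

section \<open>Affine actions from cocycles\<close>

text \<open>
  Elements of \<open>BijGroup S\<close> have to be extensional, hence the restriction.
\<close>
lemma (in group) action_hom_BijGroup:
  assumes closed: "\<And>g x. g \<in> carrier G \<Longrightarrow> x \<in> S \<Longrightarrow> f g x \<in> S"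
    and mult: "\<And>g h x. g \<in> carrier G \<Longrightarrow> h \<in> carrier G \<Longrightarrow> x \<in> S \<Longrightarrow> f (g \<otimes> h) x = f g (f h x)"
    and one: "\<And>x. x \<in> S \<Longrightarrow> f \<one> x = x"
  shows "(\<lambda>g. restrict (f g) S) \<in> hom G (BijGroup S)"
proof -
  have bij: "restrict (f g) S \<in> Bij S" if g: "g \<in> carrier G" for g
  proof -
    have "f g (f (inv g) x) = x" "f (inv g) (f g x) = x" if "x \<in> S" for x
      using mult[of g "inv g" x] mult[of "inv g" g x] g that one by auto
    then have "bij_betw (f g) S S"
      using closed g by (intro bij_betwI[where g = "f (inv g)"]) auto
    then show ?thesis by (simp add: Bij_def bij_betw_restrict_eq)
  qed
  show ?thesis
    using bij by (auto intro!: homI simp: BijGroup_def compose_def closed mult)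
qed

context ordered_abelian_group
begin

lemma lin_dist_order_aut:
  assumes f: "f \<in> carrier (ordered_aut_group \<Lambda> r)" and x: "x \<in> carrier \<Lambda>" "y \<in> carrier \<Lambda>"
  shows "lin_dist \<Lambda> r (f x) (f y) = f (lin_dist \<Lambda> r x y)"
proof -
  have mono: "(f a, f b) \<in> r" if "(a, b) \<in> r" for a b
    using f that by (auto simp: ordered_aut_group_def order_preserving_def)
  have hom: "f \<in> hom \<Lambda> \<Lambda>" and inj: "inj_on f (carrier \<Lambda>)"
    using f by (auto simp: ordered_aut_group_def auto_def Bij_def bij_betw_def)
  interpret f: group_hom \<Lambda> \<Lambda> f by unfold_locales (rule hom)
  have diff: "f a \<otimes> inv f b = f (a \<otimes> inv b)" if "a \<in> carrier \<Lambda>" "b \<in> carrier \<Lambda>" for a b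
    using that by simp
  have refl: "(a, a) \<in> r" if "a \<in> carrier \<Lambda>" for a
    using linear_order that by (auto simp: order_on_defs refl_on_def)
  have mono_inv: "(a, b) \<in> r" if "(f a, f b) \<in> r" and ab: "a \<in> carrier \<Lambda>" "b \<in> carrier \<Lambda>" for a b
  proof (rule ccontr)
    assume "(a, b) \<notin> r"
    then have "(b, a) \<in> r"
      using linear_order ab refl[OF ab(1)] by (cases "a = b") (auto simp: order_on_defs total_on_def)
    with mono have "(f b, f a) \<in> r" by blast
    with \<open>(f a, f b) \<in> r\<close> have "f a = f b"
      using linear_order by (auto simp: order_on_defs antisym_def)
    with inj ab have "a = b" by (auto dest: inj_onD)
    with \<open>(a, b) \<notin> r\<close> refl[OF ab(1)] show False by simp
  qed
  have "(f (x \<otimes> inv y), f (y \<otimes> inv x)) \<in> r \<longleftrightarrow> (x \<otimes> inv y, y \<otimes> inv x) \<in> r"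
    by (rule iffI, rule mono_inv) (simp_all add: x mono del: f.hom_mult)
  then show ?thesis unfolding lin_dist_def diff[OF x] diff[OF x(2,1)] by simp
qed

lemma lin_dist_translate:
  assumes "x \<in> carrier \<Lambda>" "y \<in> carrier \<Lambda>" "z \<in> carrier \<Lambda>"
  shows "lin_dist \<Lambda> r (x \<otimes> z) (y \<otimes> z) = lin_dist \<Lambda> r x y"
proof -
  have "(a \<otimes> z) \<otimes> inv (b \<otimes> z) = a \<otimes> inv b" if "a \<in> carrier \<Lambda>" "b \<in> carrier \<Lambda>" for a b
  proof -
    have "(a \<otimes> z) \<otimes> inv (b \<otimes> z) = a \<otimes> (z \<otimes> inv z) \<otimes> inv b"
      using assms that by (simp only: inv_mult_group m_assoc m_closed inv_closed)
    then show ?thesis using assms that by simp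
  qed
  then show ?thesis using assms by (simp add: lin_dist_def)
qed

text \<open>
  An action \<open>\<alpha>\<close> by order automorphisms and a cocycle \<open>\<nu>\<close> for it combine to \<open>x \<mapsto> \<alpha>\<^sub>g x + \<nu>\<^sub>g\<close>; the
  translation part does not change distances.
\<close>
lemma affine_action_of_cocycle:
  assumes G: "group G"
    and closed: "\<And>g x. g \<in> carrier G \<Longrightarrow> x \<in> carrier \<Lambda> \<Longrightarrow> \<alpha> g x \<in> carrier \<Lambda>"
    and add: "\<And>g x y. g \<in> carrier G \<Longrightarrow> x \<in> carrier \<Lambda> \<Longrightarrow> y \<in> carrier \<Lambda> \<Longrightarrow>
      \<alpha> g (x \<otimes> y) = \<alpha> g x \<otimes> \<alpha> g y"
    and mult: "\<And>g h x. g \<in> carrier G \<Longrightarrow> h \<in> carrier G \<Longrightarrow> x \<in> carrier \<Lambda> \<Longrightarrow>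
      \<alpha> (g \<otimes>\<^bsub>G\<^esub> h) x = \<alpha> g (\<alpha> h x)"
    and one: "\<And>x. x \<in> carrier \<Lambda> \<Longrightarrow> \<alpha> \<one>\<^bsub>G\<^esub> x = x"
    and mono: "\<And>g x y. g \<in> carrier G \<Longrightarrow> (x, y) \<in> r \<Longrightarrow> (\<alpha> g x, \<alpha> g y) \<in> r"
    and \<nu>: "\<And>g. g \<in> carrier G \<Longrightarrow> \<nu> g \<in> carrier \<Lambda>"
    and cocycle: "\<And>g h. g \<in> carrier G \<Longrightarrow> h \<in> carrier G \<Longrightarrow> \<nu> (g \<otimes>\<^bsub>G\<^esub> h) = \<nu> g \<otimes> \<alpha> g (\<nu> h)"
  defines "\<phi> \<equiv> \<lambda>g. \<lambda>x\<in>carrier \<Lambda>. \<alpha> g x \<otimes> \<nu> g"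
  shows "affine_action G \<Lambda> r \<phi> \<and> orientation_preserving_action G r \<phi>"
proof -
  interpret G: group G by (rule G)
  let ?\<alpha> = "\<lambda>g. restrict (\<alpha> g) (carrier \<Lambda>)"
  have r: "x \<in> carrier \<Lambda>" "y \<in> carrier \<Lambda>" if "(x, y) \<in> r" for x y
    using linear_order that by (auto simp: order_on_defs)
  have \<alpha>_Bij: "?\<alpha> \<in> hom G (BijGroup (carrier \<Lambda>))"
    by (rule G.action_hom_BijGroup) (use closed mult one in auto)
  have \<alpha>_aut: "?\<alpha> g \<in> carrier (ordered_aut_group \<Lambda> r)" if "g \<in> carrier G" for g
    using that hom_in_carrier[OF \<alpha>_Bij that]
    by (auto simp: ordered_aut_group_def auto_def BijGroup_def order_preserving_def
        intro!: homI closed add mono dest: r)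
  have \<alpha>_hom: "?\<alpha> \<in> hom G (ordered_aut_group \<Lambda> r)"
    using \<alpha>_aut hom_mult[OF \<alpha>_Bij]
    by (intro homI) (auto simp: ordered_aut_group_def AutoGroup_def)
  have \<nu>_one: "\<nu> \<one>\<^bsub>G\<^esub> = \<one>"
    using cocycle[of "\<one>\<^bsub>G\<^esub>" "\<one>\<^bsub>G\<^esub>"] one[OF \<nu>] \<nu>[of "\<one>\<^bsub>G\<^esub>"] by simp
  have "(\<lambda>g. restrict (\<lambda>x. \<alpha> g x \<otimes> \<nu> g) (carrier \<Lambda>)) \<in> hom G (BijGroup (carrier \<Lambda>))"
  proof (rule G.action_hom_BijGroup)
    fix g h x assume gh: "g \<in> carrier G" "h \<in> carrier G" and x: "x \<in> carrier \<Lambda>"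
    then show "\<alpha> (g \<otimes>\<^bsub>G\<^esub> h) x \<otimes> \<nu> (g \<otimes>\<^bsub>G\<^esub> h) = \<alpha> g (\<alpha> h x \<otimes> \<nu> h) \<otimes> \<nu> g"
      by (simp add: mult cocycle add closed \<nu> m_ac)
  qed (auto simp: closed \<nu> one \<nu>_one)
  then have "group_action G (carrier \<Lambda>) \<phi>"
    unfolding \<phi>_def group_action_def group_hom_def group_hom_axioms_def
    by (simp add: G group_BijGroup)
  moreover have "lin_dist \<Lambda> r (\<phi> g x) (\<phi> g y) = ?\<alpha> g (lin_dist \<Lambda> r x y)"
    if "g \<in> carrier G" "x \<in> carrier \<Lambda>" "y \<in> carrier \<Lambda>" for g x y
    using lin_dist_order_aut[OF \<alpha>_aut[OF that(1)] that(2,3)] that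
    by (simp add: \<phi>_def lin_dist_translate closed \<nu>)
  ultimately have "affine_action G \<Lambda> r \<phi>"
    using \<alpha>_hom unfolding affine_action_def alpha_affine_action_def by blast
  moreover have "orientation_preserving_action G r \<phi>"
    by (auto simp: orientation_preserving_action_def order_preserving_def \<phi>_def \<nu>
        intro!: translation_invariant mono dest: r)
  ultimately show ?thesis ..
qed

text \<open>
  A map that moves every point upwards moves the right end point of a segment out of it, and one that
  moves every point downwards the left end point; the inverse moves all points the opposite way.
\<close>
lemma rigid_hyperbolic_if_moves_one_way:
  assumes bij: "bij_betw f (carrier \<Lambda>) (carrier \<Lambda>)" and
    "(\<forall>x\<in>carrier \<Lambda>. f x \<noteq> x \<and> (x, f x) \<in> r) \<or> (\<forall>x\<in>carrier \<Lambda>. f x \<noteq> x \<and> (f x, x) \<in> r)"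
  shows "rigid \<Lambda> r f" "hyperbolic \<Lambda> f"
proof -
  have antisym: "x = y" if "(x, y) \<in> r" "(y, x) \<in> r" for x y
    using linear_order that by (auto simp: order_on_defs antisym_def)
  have not_proper: "\<not> h ` segment r a b \<subset> segment r a b"
    if h: "(\<forall>x\<in>carrier \<Lambda>. h x \<noteq> x \<and> (x, h x) \<in> r) \<or> (\<forall>x\<in>carrier \<Lambda>. h x \<noteq> x \<and> (h x, x) \<in> r)"
      and ab: "a \<in> carrier \<Lambda>" "b \<in> carrier \<Lambda>" for h a b
  proof
    assume sub: "h ` segment r a b \<subset> segment r a b"
    then obtain m where "(a, m) \<in> r" "(m, b) \<in> r" by (auto simp: segment_def)
    then have "(a, b) \<in> r"
      using linear_order by (auto simp: order_on_defs dest: transD)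
    then have "a \<in> segment r a b" "b \<in> segment r a b"
      using linear_order ab by (auto simp: segment_def order_on_defs refl_on_def)
    with sub have "(a, h a) \<in> r" "(h b, b) \<in> r" by (auto simp: segment_def)
    with h ab antisym show False by blast
  qed
  let ?f' = "inv_into (carrier \<Lambda>) f"
  have f': "f (?f' x) = x" "?f' x \<in> carrier \<Lambda>" if "x \<in> carrier \<Lambda>" for x
    using bij that by (auto simp: bij_betw_def f_inv_into_f inv_into_into)
  from assms(2)
  have "(\<forall>x\<in>carrier \<Lambda>. ?f' x \<noteq> x \<and> (x, ?f' x) \<in> r) \<or> (\<forall>x\<in>carrier \<Lambda>. ?f' x \<noteq> x \<and> (?f' x, x) \<in> r)"
  proof
    assume up: "\<forall>x\<in>carrier \<Lambda>. f x \<noteq> x \<and> (x, f x) \<in> r"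
    have "?f' x \<noteq> x \<and> (?f' x, x) \<in> r" if "x \<in> carrier \<Lambda>" for x
      using bspec[OF up f'(2)[OF that]] f'(1)[OF that] by auto
    then show ?thesis by blast
  next
    assume down: "\<forall>x\<in>carrier \<Lambda>. f x \<noteq> x \<and> (f x, x) \<in> r"
    have "?f' x \<noteq> x \<and> (x, ?f' x) \<in> r" if "x \<in> carrier \<Lambda>" for x
      using bspec[OF down f'(2)[OF that]] f'(1)[OF that] by auto
    then show ?thesis by blast
  qed
  then show "rigid \<Lambda> r f"
    unfolding rigid_def by (intro ballI conjI not_proper assms(2))
  show "hyperbolic \<Lambda> f" using assms(2) by (auto simp: hyperbolic_def)
qed

end

section \<open>Lexicographic orders on finitely supported functions\<close>

definition fin_supp_group :: "'i set \<Rightarrow> ('i \<Rightarrow> int) monoid" where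
  "fin_supp_group J =
     \<lparr>carrier = {m. finite {i. m i \<noteq> 0} \<and> {i. m i \<noteq> 0} \<subseteq> J},
      mult = \<lambda>a b i. a i + b i, one = \<lambda>_. 0\<rparr>"

lemma fin_supp_group_simps [simp]:
  "a \<otimes>\<^bsub>fin_supp_group J\<^esub> b = (\<lambda>i. a i + b i)"
  "\<one>\<^bsub>fin_supp_group J\<^esub> = (\<lambda>_. 0)"
  by (simp_all add: fin_supp_group_def)

lemma carrier_fin_supp_group:
  "m \<in> carrier (fin_supp_group J) \<longleftrightarrow> finite {i. m i \<noteq> 0} \<and> (\<forall>i. m i \<noteq> 0 \<longrightarrow> i \<in> J)"
  by (auto simp: fin_supp_group_def)

lemma fin_supp_outside: "m \<in> carrier (fin_supp_group J) \<Longrightarrow> i \<notin> J \<Longrightarrow> m i = 0"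
  unfolding carrier_fin_supp_group by blast

lemma fin_supp_diff:
  assumes "a \<in> carrier (fin_supp_group J)" "b \<in> carrier (fin_supp_group J)"
  shows "(\<lambda>i. a i - b i) \<in> carrier (fin_supp_group J)"
proof -
  have "finite {i. a i - b i \<noteq> 0}"
    by (rule finite_subset[of _ "{i. a i \<noteq> 0} \<union> {i. b i \<noteq> 0}"])
      (use assms in \<open>auto simp: carrier_fin_supp_group\<close>)
  then show ?thesis
    using assms unfolding carrier_fin_supp_group by (metis diff_0_right)
qed

lemma comm_group_fin_supp_group: "comm_group (fin_supp_group J)"
proof (rule comm_groupI)
  have zero: "(\<lambda>_. 0) \<in> carrier (fin_supp_group J)" by (simp add: carrier_fin_supp_group)
  have neg: "(\<lambda>i. - a i) \<in> carrier (fin_supp_group J)" if "a \<in> carrier (fin_supp_group J)" for a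
    using fin_supp_diff[OF zero that] by simp
  show "a \<otimes>\<^bsub>fin_supp_group J\<^esub> b \<in> carrier (fin_supp_group J)"
    if "a \<in> carrier (fin_supp_group J)" "b \<in> carrier (fin_supp_group J)" for a b
    using fin_supp_diff[OF that(1) neg[OF that(2)]] by simp
  show "\<exists>b\<in>carrier (fin_supp_group J). b \<otimes>\<^bsub>fin_supp_group J\<^esub> a = \<one>\<^bsub>fin_supp_group J\<^esub>"
    if "a \<in> carrier (fin_supp_group J)" for a
    using neg[OF that] by (intro bexI[of _ "\<lambda>i. - a i"]) auto
qed (auto simp: carrier_fin_supp_group add.assoc add.commute)

text \<open>
  The value at the \<open>lt\<close>-largest index of the support is positive.
\<close>
definition lead_pos :: "('i \<Rightarrow> 'i \<Rightarrow> bool) \<Rightarrow> ('i \<Rightarrow> int) \<Rightarrow> bool" where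
  "lead_pos lt m \<longleftrightarrow> (\<exists>i. m i > 0 \<and> (\<forall>j. m j \<noteq> 0 \<longrightarrow> j = i \<or> lt j i))"

locale linear_index =
  fixes J :: "'i set" and lt :: "'i \<Rightarrow> 'i \<Rightarrow> bool"
  assumes transp: "transp_on J lt" and asymp: "asymp_on J lt" and total: "totalp_on J lt"
begin

abbreviation L :: "('i \<Rightarrow> int) monoid" where "L \<equiv> fin_supp_group J"

lemma lead_pos_add:
  assumes "a \<in> carrier L" "b \<in> carrier L" "lead_pos lt a" "lead_pos lt b"
  shows "lead_pos lt (\<lambda>i. a i + b i)"
proof -
  obtain i where i: "a i > 0" "\<And>j. a j \<noteq> 0 \<Longrightarrow> j = i \<or> lt j i"
    using assms(3) by (auto simp: lead_pos_def)
  obtain k where k: "b k > 0" "\<And>j. b j \<noteq> 0 \<Longrightarrow> j = k \<or> lt j k"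
    using assms(4) by (auto simp: lead_pos_def)
  have J: "a j \<noteq> 0 \<Longrightarrow> j \<in> J" "b j \<noteq> 0 \<Longrightarrow> j \<in> J" for j
    using assms(1,2) by (auto simp: carrier_fin_supp_group)
  have ik: "i \<in> J" "k \<in> J" using J i(1) k(1) by (metis less_irrefl)+
  have trans: "lt x z" if "lt x y" "lt y z" "x \<in> J" "y \<in> J" "z \<in> J" for x y z
    using transp_onD[OF transp] that by blast
  have asym: "\<not> lt y x" if "lt x y" "x \<in> J" "y \<in> J" for x y
    using asymp_onD[OF asymp] that by blast
  have ab_nonzero: "a j \<noteq> 0 \<or> b j \<noteq> 0" if "a j + b j \<noteq> 0" for j using that by auto
  consider "i = k" | "lt i k" | "lt k i" using totalp_onD[OF total ik] by blast
  then show ?thesis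
  proof cases
    case 1
    then have "a k + b k > 0" using i(1) k(1) by simp
    then show ?thesis
      using 1 i(2) k(2) ab_nonzero unfolding lead_pos_def by blast
  next
    case 2
    then have "a k = 0" using i(2)[of k] asym ik by blast
    then have "a k + b k > 0" using k(1) by simp
    moreover have "j = k \<or> lt j k" if "a j + b j \<noteq> 0" for j
      using ab_nonzero[OF that] i(2)[of j] k(2)[of j] 2 trans[of j i k] ik J by blast
    ultimately show ?thesis unfolding lead_pos_def by blast
  next
    case 3
    then have "b i = 0" using k(2)[of i] asym ik by blast
    then have "a i + b i > 0" using i(1) by simp
    moreover have "j = i \<or> lt j i" if "a j + b j \<noteq> 0" for j
      using ab_nonzero[OF that] i(2)[of j] k(2)[of j] 3 trans[of j k i] ik J by blast
    ultimately show ?thesis unfolding lead_pos_def by blast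
  qed
qed

text \<open>
  Finiteness of the support is what provides a largest index.
\<close>
lemma lead_pos_cases:
  assumes m: "m \<in> carrier L" and "m \<noteq> (\<lambda>_. 0)"
  shows "lead_pos lt m \<or> lead_pos lt (\<lambda>i. - m i)"
proof -
  let ?S = "{i. m i \<noteq> 0}"
  have "?S \<subseteq> J" "finite ?S" "?S \<noteq> {}" using assms by (auto simp: carrier_fin_supp_group)
  then obtain i where i: "i \<in> ?S" "\<forall>j\<in>?S. j \<noteq> i \<longrightarrow> lt j i"
    using Finite_Set.bex_greatest_element[of ?S lt] transp total
    by (meson transp_on_subset totalp_on_subset)
  then show ?thesis
    unfolding lead_pos_def by (cases "m i > 0") (auto intro!: exI[of _ i])
qed

lemma not_lead_pos_zero: "\<not> lead_pos lt (\<lambda>_. 0)"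
  by (simp add: lead_pos_def)

lemma not_lead_pos_both:
  assumes "m \<in> carrier L" "lead_pos lt m" shows "\<not> lead_pos lt (\<lambda>i. - m i)"
  using lead_pos_add[OF assms(1) _ assms(2), of "\<lambda>i. - m i"] assms(1)
  by (auto simp: carrier_fin_supp_group not_lead_pos_zero)

definition lex_order :: "('i \<Rightarrow> int) rel" where
  "lex_order = {(a, b). a \<in> carrier L \<and> b \<in> carrier L \<and> (a = b \<or> lead_pos lt (\<lambda>i. b i - a i))}"

lemma ordered_abelian_group_lex_order: "ordered_abelian_group L lex_order"
proof -
  interpret comm_group L by (rule comm_group_fin_supp_group)
  have "trans lex_order"
  proof (rule transI)
    fix a b c assume ab: "(a, b) \<in> lex_order" and bc: "(b, c) \<in> lex_order"
    show "(a, c) \<in> lex_order"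
    proof (cases "a = b \<or> b = c")
      case False
      then have "lead_pos lt (\<lambda>i. (b i - a i) + (c i - b i))"
        using ab bc by (intro lead_pos_add) (auto simp: lex_order_def intro: fin_supp_diff)
      then show ?thesis using ab bc by (simp add: lex_order_def)
    qed (use ab bc in auto)
  qed
  moreover have "antisym lex_order"
  proof (rule antisymI)
    fix a b assume "(a, b) \<in> lex_order" "(b, a) \<in> lex_order"
    then show "a = b"
      using not_lead_pos_both[of "\<lambda>i. b i - a i"] by (auto simp: lex_order_def fin_supp_diff)
  qed
  moreover have "total_on (carrier L) lex_order"
  proof (rule total_onI)
    fix a b assume ab: "a \<in> carrier L" "b \<in> carrier L" "a \<noteq> b"
    then have "(\<lambda>i. b i - a i) \<noteq> (\<lambda>_. 0)" by (metis eq_iff_diff_eq_0 ext)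
    with lead_pos_cases[OF fin_supp_diff[OF ab(2,1)]]
    show "(a, b) \<in> lex_order \<or> (b, a) \<in> lex_order" using ab by (auto simp: lex_order_def)
  qed
  ultimately have "linear_order_on (carrier L) lex_order"
    by (auto simp: order_on_defs lex_order_def refl_on_def)
  then show ?thesis
  proof unfold_locales
    fix x y z assume "(x, y) \<in> lex_order" and z: "z \<in> carrier L"
    then have xy: "x \<in> carrier L" "y \<in> carrier L" "x = y \<or> lead_pos lt (\<lambda>i. y i - x i)"
      by (auto simp: lex_order_def)
    then show "(x \<otimes>\<^bsub>L\<^esub> z, y \<otimes>\<^bsub>L\<^esub> z) \<in> lex_order"
      using m_closed[OF xy(1) z] m_closed[OF xy(2) z] by (auto simp: lex_order_def)
  qed
qed

end

section \<open>The ordered group acted on\<close>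

text \<open>
  An index \<open>(k, x, c)\<close> is the edge \<open>(x, c)\<close> of the Cayley graph of stage \<open>k\<close>. For \<open>k < d\<close>, the finitely
  supported functions on the edges of stage \<open>k\<close> form the free module with basis the letters over the
  group ring of stage \<open>k\<close>; their direct sum is the group on which stage \<open>d\<close> acts, with linear part
  \<open>shift d\<close> and translation part \<open>cocycle d\<close>.
\<close>
type_synonym 'a index = "nat \<times> 'a \<times> 'a word set"

definition index_set :: "nat \<Rightarrow> 'a index set" where
  "index_set d = {(k, x, c). k < d \<and> c \<in> range (soluble_class k)}"

definition index_translate :: "'a word \<Rightarrow> 'a index \<Rightarrow> 'a index" where
  "index_translate w = (\<lambda>(k, x, c). (k, x, tower.translate k w c))"

definition shift :: "nat \<Rightarrow> 'a word \<Rightarrow> ('a index \<Rightarrow> int) \<Rightarrow> 'a index \<Rightarrow> int" where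
  "shift d w m = (\<lambda>i. if i \<in> index_set d then m (index_translate (inv_word w) i) else 0)"

definition cocycle :: "nat \<Rightarrow> 'a word \<Rightarrow> 'a index \<Rightarrow> int" where
  "cocycle d w = (\<lambda>(k, x, c). if k < d then tower.flow k w (x, c) else 0)"

lemma index_translate_in_index_set [simp]:
  "index_translate w i \<in> index_set d \<longleftrightarrow> fst i < d"
  by (auto simp: index_set_def index_translate_def split: prod.splits)

lemma index_set_cases:
  assumes "i \<in> index_set d"
  obtains k x c where "i = (k, x, c)" "k < d" "c \<in> range (soluble_class k)"
  using assms unfolding index_set_def by blast

lemma index_set_imp_fst_less: "i \<in> index_set d \<Longrightarrow> fst i < d"
  by (auto simp: index_set_def)

lemma index_translate_append:
  "index_translate (u @ v) i = index_translate u (index_translate v i)"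
  by (auto simp: index_translate_def tower.translate_append split: prod.splits)

lemma index_translate_inv [simp]:
  assumes "i \<in> index_set d"
  shows "index_translate u (index_translate (inv_word u) i) = i"
    and "index_translate (inv_word u) (index_translate u i) = i"
proof -
  obtain k x c where "i = (k, x, c)" "c \<in> range (soluble_class k)"
    using assms unfolding index_set_def by blast
  then show "index_translate u (index_translate (inv_word u) i) = i"
    and "index_translate (inv_word u) (index_translate u i) = i"
    by (simp_all add: index_translate_def tower.translate_inv del: tower.translate_C)
qed

lemma index_translate_trivial:
  assumes "i \<in> index_set d" and "soluble_class (fst i) u = soluble_class (fst i) []"
  shows "index_translate u i = i"
proof -
  obtain k x c where i: "i = (k, x, c)" and c: "c \<in> range (soluble_class k)"
    using assms(1) unfolding index_set_def by blast
  have "soluble_class k u = soluble_class k []" using assms(2) by (simp add: i)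
  from tower.translate_Nil[OF c this] show ?thesis by (simp add: i index_translate_def)
qed

lemma shift_closed:
  assumes "m \<in> carrier (fin_supp_group (index_set d))"
  shows "shift d w m \<in> carrier (fin_supp_group (index_set d))"
proof -
  have "{i. shift d w m i \<noteq> 0} \<subseteq> index_translate w ` {i. m i \<noteq> 0}"
  proof
    fix i assume "i \<in> {i. shift d w m i \<noteq> 0}"
    then have "i \<in> index_set d" "m (index_translate (inv_word w) i) \<noteq> 0"
      by (auto simp: shift_def split: if_splits)
    then show "i \<in> index_translate w ` {i. m i \<noteq> 0}"
      by (intro image_eqI[of _ _ "index_translate (inv_word w) i"]) simp_all
  qed
  moreover have "finite (index_translate w ` {i. m i \<noteq> 0})"
    using assms by (simp add: carrier_fin_supp_group)
  ultimately have "finite {i. shift d w m i \<noteq> 0}" by (rule finite_subset)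
  then show ?thesis by (simp add: carrier_fin_supp_group shift_def)
qed

lemma shift_append: "shift d (u @ v) m = shift d u (shift d v m)"
proof
  fix i
  have "index_translate (inv_word u) i \<in> index_set d" if "i \<in> index_set d"
    using index_set_imp_fst_less[OF that] by simp
  then show "shift d (u @ v) m i = shift d u (shift d v m) i"
    by (simp add: shift_def index_translate_append)
qed

lemma shift_cong:
  assumes "soluble_class d u = soluble_class d v" shows "shift d u = shift d v"
proof -
  have "index_translate (inv_word u) i = index_translate (inv_word v) i"
    if "i \<in> index_set d" for i :: "'a index"
  proof -
    have "soluble_class (fst i) u = soluble_class (fst i) v"
      using soluble_class_mono[OF assms] index_set_imp_fst_less[OF that] by simp
    then have "tower.translate (fst i) (inv_word u) c = tower.translate (fst i) (inv_word v) c" for c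
      by (intro tower.translate_cong tower.cong_inv_word)
    then show ?thesis by (simp add: index_translate_def case_prod_unfold)
  qed
  then show ?thesis by (auto simp: shift_def fun_eq_iff)
qed

lemma shift_Nil:
  assumes "m \<in> carrier (fin_supp_group (index_set d))"
  shows "shift d [] m = m"
proof
  fix i show "shift d [] m i = m i"
    using index_translate_trivial[of i d "[]"] fin_supp_outside[OF assms, of i]
    by (simp add: shift_def)
qed

lemma cocycle_closed: "cocycle d w \<in> carrier (fin_supp_group (index_set d))"
proof -
  have "{i. cocycle d w i \<noteq> 0} \<subseteq> (\<Union>k<d. Pair k ` {e. tower.flow k w e \<noteq> 0})"
    by (auto simp: cocycle_def split: if_splits)
  moreover have "finite \<dots>" using tower.finite_flow by auto
  ultimately have "finite {i. cocycle d w i \<noteq> 0}" by (rule finite_subset)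
  moreover have "i \<in> index_set d" if "cocycle d w i \<noteq> 0" for i
  proof -
    obtain k x c where i: "i = (k, x, c)" by (rule prod_cases3)
    with that have "k < d" "tower.flow k w (x, c) \<noteq> 0"
      by (simp_all add: cocycle_def split: if_splits)
    then show ?thesis using tower.flow_outside[of c k "[]" w x] unfolding i index_set_def by blast
  qed
  ultimately show ?thesis by (simp add: carrier_fin_supp_group)
qed

lemma cocycle_append:
  "cocycle d (u @ v) = (\<lambda>i. cocycle d u i + shift d u (cocycle d v) i)"
proof
  fix i :: "'a index"
  show "cocycle d (u @ v) i = cocycle d u i + shift d u (cocycle d v) i"
  proof (cases "i \<in> index_set d")
    case True
    then obtain k x p where "i = (k, x, soluble_class k p)" "k < d"
      by (auto simp: index_set_def)
    with True show ?thesis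
      by (simp add: cocycle_def shift_def index_translate_def tower.flow_append)
  next
    case False
    then have "cocycle d w i = 0" for w by (rule fin_supp_outside[OF cocycle_closed])
    with False show ?thesis by (simp add: shift_def)
  qed
qed

text \<open>
  In particular the action is faithful: the translation part already determines the element.
\<close>
lemma cocycle_eq_iff: "cocycle d u = cocycle d v \<longleftrightarrow> soluble_class d u = soluble_class d v"
proof
  assume eq: "cocycle d u = cocycle d v"
  have "tower.flow k u (x, c) = tower.flow k v (x, c)" if "k < d" for k x c
    using fun_cong[OF eq, of "(k, x, c)"] that by (simp add: cocycle_def)
  then show "soluble_class d u = soluble_class d v" by (auto simp: soluble_class_eq_iff fun_eq_iff)
next
  assume "soluble_class d u = soluble_class d v"
  then show "cocycle d u = cocycle d v" by (auto simp: soluble_class_eq_iff cocycle_def fun_eq_iff)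
qed

lemma cocycle_Nil [simp]: "cocycle d [] = (\<lambda>_. 0)"
  by (auto simp: cocycle_def fun_eq_iff)

section \<open>Left-invariant orders on the tower\<close>

text \<open>
  Stated on classes of words; invariance under translation is phrased by words representing both
  sides, so that it says nothing about sets that are not classes.
\<close>
definition left_invariant_order :: "nat \<Rightarrow> ('a word set \<Rightarrow> 'a word set \<Rightarrow> bool) \<Rightarrow> bool" where
  "left_invariant_order k r \<longleftrightarrow>
     transp_on (range (soluble_class k)) r \<and> asymp_on (range (soluble_class k)) r \<and>
     totalp_on (range (soluble_class k)) r \<and>
     (\<forall>w u v. r (soluble_class k u) (soluble_class k v) \<longrightarrow>
        r (soluble_class k (w @ u)) (soluble_class k (w @ v)))"

text \<open>
  Lower stages dominate: an index of a lower stage is larger. Within a stage the vertex counts before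
  the letter, and the order of letters, which are not moved by the group, can be arbitrary.
\<close>
definition index_less ::
  "('a \<Rightarrow> 'a \<Rightarrow> bool) \<Rightarrow> (nat \<Rightarrow> 'a word set \<Rightarrow> 'a word set \<Rightarrow> bool) \<Rightarrow> 'a index \<Rightarrow> 'a index \<Rightarrow> bool"
  where "index_less l R = (\<lambda>(k, x, c) (k', x', c').
     k' < k \<or> k = k' \<and> (R k c c' \<or> c = c' \<and> l x x'))"

locale ordered_tower =
  fixes d :: nat and l :: "'a \<Rightarrow> 'a \<Rightarrow> bool"
    and R :: "nat \<Rightarrow> 'a word set \<Rightarrow> 'a word set \<Rightarrow> bool"
  assumes l: "transp_on UNIV l" "asymp_on UNIV l" "totalp_on UNIV l"
    and R: "k < d \<Longrightarrow> left_invariant_order k (R k)"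

sublocale ordered_tower \<subseteq> linear_index "index_set d" "index_less l R"
proof
  have transp: "transp_on (range (soluble_class k)) (R k)"
    and asymp: "asymp_on (range (soluble_class k)) (R k)"
    and totalp: "totalp_on (range (soluble_class k)) (R k)" if "k < d" for k
    using R[OF that] by (simp_all add: left_invariant_order_def)

  show "transp_on (index_set d) (index_less l R)"
  proof (rule transp_onI)
    fix i i' i'' :: "'a index" assume "i \<in> index_set d" "i' \<in> index_set d" "i'' \<in> index_set d"
      and less: "index_less l R i i'" "index_less l R i' i''"
    from this(1) obtain k x c
      where i: "i = (k, x, c)" "k < d" "c \<in> range (soluble_class k)" by (rule index_set_cases)
    from \<open>i' \<in> index_set d\<close> obtain k' x' c'
      where i': "i' = (k', x', c')" "k' < d" "c' \<in> range (soluble_class k')" by (rule index_set_cases)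
    from \<open>i'' \<in> index_set d\<close> obtain k'' x'' c''
      where i'': "i'' = (k'', x'', c'')" "k'' < d" "c'' \<in> range (soluble_class k'')" by (rule index_set_cases)
    show "index_less l R i i''"
    proof (cases "k = k' \<and> k' = k''")
      case True
      with less have "R k c c' \<or> c = c' \<and> l x x'" "R k c' c'' \<or> c' = c'' \<and> l x' x''"
        by (auto simp: index_less_def i i' i'')
      moreover have "R k c c''" if "R k c c'" "R k c' c''"
        using transp_onD[OF transp[OF i(2)]] that i i' i'' True by blast
      moreover have "l x x''" if "l x x'" "l x' x''"
        using transp_onD[OF l(1)] that by blast
      ultimately have "R k c c'' \<or> c = c'' \<and> l x x''" by blast
      then show ?thesis using True by (simp add: index_less_def i i'')
    next
      case False
      with less show ?thesis by (auto simp: index_less_def i i' i'')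
    qed
  qed
  show "asymp_on (index_set d) (index_less l R)"
  proof (rule asymp_onI)
    fix i i' :: "'a index" assume "i \<in> index_set d" "i' \<in> index_set d" and less: "index_less l R i i'"
    from this(1) obtain k x c
      where i: "i = (k, x, c)" "k < d" "c \<in> range (soluble_class k)" by (rule index_set_cases)
    from \<open>i' \<in> index_set d\<close> obtain k' x' c'
      where i': "i' = (k', x', c')" "k' < d" "c' \<in> range (soluble_class k')" by (rule index_set_cases)
    show "\<not> index_less l R i' i"
    proof (cases "k = k'")
      case True
      have "\<not> R k c' c" if "R k c c'"
        using asymp_onD[OF asymp[OF i(2)]] that i i' True by blast
      moreover have "\<not> R k c c" using asymp_onD[OF asymp[OF i(2)]] i by blast
      moreover have "\<not> l x' x" if "l x x'" using asymp_onD[OF l(2)] that by blast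
      ultimately show ?thesis using less True by (auto simp: index_less_def i i')
    next
      case False
      with less show ?thesis by (auto simp: index_less_def i i')
    qed
  qed
  show "totalp_on (index_set d) (index_less l R)"
  proof (rule totalp_onI)
    fix i i' :: "'a index" assume "i \<in> index_set d" "i' \<in> index_set d" and neq: "i \<noteq> i'"
    from this(1) obtain k x c
      where i: "i = (k, x, c)" "k < d" "c \<in> range (soluble_class k)" by (rule index_set_cases)
    from \<open>i' \<in> index_set d\<close> obtain k' x' c'
      where i': "i' = (k', x', c')" "k' < d" "c' \<in> range (soluble_class k')" by (rule index_set_cases)
    show "index_less l R i i' \<or> index_less l R i' i"
    proof (cases "k = k'")
      case True
      have "R k c c' \<or> R k c' c" if "c \<noteq> c'"
        using totalp_onD[OF totalp[OF i(2)]] that i i' True by blast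
      moreover have "l x x' \<or> l x' x" if "x \<noteq> x'" using totalp_onD[OF l(3)] that by blast
      ultimately show ?thesis using neq True by (auto simp: index_less_def i i')
    qed (auto simp: index_less_def i i')
  qed
qed

context ordered_tower
begin

lemma index_less_translate:
  assumes "i \<in> index_set d" "j \<in> index_set d" "index_less l R i j"
  shows "index_less l R (index_translate w i) (index_translate w j)"
proof -
  from assms(1) obtain k x u where i: "i = (k, x, soluble_class k u)" "k < d"
    by (elim index_set_cases imageE) simp
  from assms(2) obtain k' x' u' where j: "j = (k', x', soluble_class k' u')"
    by (elim index_set_cases imageE) simp
  have R_translate: "R k (soluble_class k (w @ u)) (soluble_class k (w @ v))"
    if "R k (soluble_class k u) (soluble_class k v)" for v
    using R[OF i(2)] that unfolding left_invariant_order_def by blast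
  from assms(3) consider "k' < k"
    | "k = k'" "R k (soluble_class k u) (soluble_class k u')"
    | "k = k'" "soluble_class k u = soluble_class k u'" "l x x'"
    unfolding i j index_less_def by fast
  then show ?thesis
  proof cases
    case 3
    from tower.cong[OF refl 3(2)] have "soluble_class k (w @ u) = soluble_class k (w @ u')" .
    with 3 show ?thesis by (simp add: i j index_less_def index_translate_def)
  qed (use R_translate in \<open>simp_all add: i j index_less_def index_translate_def\<close>)
qed

lemma lead_pos_shift:
  assumes m: "m \<in> carrier L" and "lead_pos (index_less l R) m"
  shows "lead_pos (index_less l R) (shift d w m)"
proof -
  obtain i where i: "m i > 0" "\<And>j. m j \<noteq> 0 \<Longrightarrow> j = i \<or> index_less l R j i"
    using assms(2) by (auto simp: lead_pos_def)
  have iJ: "i \<in> index_set d" using i(1) fin_supp_outside[OF m, of i] by (cases "i \<in> index_set d") simp_all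
  show ?thesis unfolding lead_pos_def
  proof (intro exI conjI allI impI)
    show "shift d w m (index_translate w i) > 0"
      using i(1) iJ by (simp add: shift_def index_set_imp_fst_less)
    fix j assume "shift d w m j \<noteq> 0"
    then have j: "j \<in> index_set d" "m (index_translate (inv_word w) j) \<noteq> 0"
      by (auto simp: shift_def split: if_splits)
    from i(2)[OF j(2)] show "j = index_translate w i \<or> index_less l R j (index_translate w i)"
    proof
      assume "index_translate (inv_word w) j = i"
      then show ?thesis using j(1) by auto
    next
      assume less: "index_less l R (index_translate (inv_word w) j) i"
      have "index_translate (inv_word w) j \<in> index_set d"
        using j(1) by (simp add: index_set_imp_fst_less)
      from index_less_translate[OF this iJ less, of w] show ?thesis using j(1) by simp
    qed
  qed
qed

text \<open>
  Stage \<open>d\<close> is ordered by its orbit of \<open>0\<close>, which is the range of the cocycle. The order is left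
  invariant because the action is order preserving.
\<close>
lemma left_invariant_order_pullback:
  "left_invariant_order d (\<lambda>c c'. lead_pos (index_less l R)
     (\<lambda>i. cocycle d (tower.rep d c') i - cocycle d (tower.rep d c) i))"
proof -
  define P where "P u v \<longleftrightarrow> lead_pos (index_less l R) (\<lambda>i. cocycle d v i - cocycle d u i)" for u v
  have diff: "(\<lambda>i. cocycle d v i - cocycle d u i) \<in> carrier L" for u v :: "'a word"
    by (intro fin_supp_diff cocycle_closed)
  have P_class: "lead_pos (index_less l R) (\<lambda>i. cocycle d (tower.rep d (soluble_class d v)) i -
      cocycle d (tower.rep d (soluble_class d u)) i) \<longleftrightarrow> P u v" for u v
  proof -
    have "cocycle d (tower.rep d (soluble_class d w)) = cocycle d w" for w :: "'a word"
      by (simp add: cocycle_eq_iff)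
    then show ?thesis by (simp add: P_def)
  qed
  have trans: "P u w" if "P u v" "P v w" for u v w
    using lead_pos_add[OF diff diff that[unfolded P_def]] by (simp add: P_def)
  have asym: "\<not> P v u" if "P u v" for u v
    using not_lead_pos_both[OF diff that[unfolded P_def]] by (simp add: P_def)
  have total: "P u v \<or> P v u" if "soluble_class d u \<noteq> soluble_class d v" for u v
  proof -
    have "(\<lambda>i. cocycle d v i - cocycle d u i) \<noteq> (\<lambda>_. 0)"
      using that unfolding cocycle_eq_iff[symmetric] by (metis eq_iff_diff_eq_0 ext)
    from lead_pos_cases[OF diff this] show ?thesis by (simp add: P_def)
  qed
  have "P (w @ u) (w @ v)" if "P u v" for u v w
  proof -
    have "shift d w (\<lambda>i. cocycle d v i - cocycle d u i) =
        (\<lambda>i. cocycle d (w @ v) i - cocycle d (w @ u) i)"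
      by (auto simp: cocycle_append shift_def)
    with lead_pos_shift[OF diff that[unfolded P_def], of w] show ?thesis by (simp add: P_def)
  qed
  note invariant = this
  show ?thesis
    unfolding left_invariant_order_def
    by (intro conjI transp_onI asymp_onI totalp_onI allI impI; (elim rangeE)?; simp only: P_class)
      (metis trans asym total invariant)+
qed

section \<open>Essential freeness\<close>

text \<open>
  Indices of stage at most \<open>k\<close> dominate all others, so the sign is decided there.
\<close>
lemma lead_pos_if_eq_on_top_levels:
  assumes a: "lead_pos (index_less l R) a" and eq: "\<And>i. fst i \<le> k \<Longrightarrow> b i = a i"
    and nonzero: "a i\<^sub>0 \<noteq> 0" "fst i\<^sub>0 \<le> k"
  shows "lead_pos (index_less l R) b"
proof -
  obtain i where i: "a i > 0" "\<And>j. a j \<noteq> 0 \<Longrightarrow> j = i \<or> index_less l R j i"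
    using a by (auto simp: lead_pos_def)
  have ik: "fst i \<le> k"
    using i(2)[OF nonzero(1)] nonzero(2) by (auto simp: index_less_def split: prod.splits)
  show ?thesis unfolding lead_pos_def
  proof (intro exI conjI allI impI)
    show "b i > 0" using i(1) eq[OF ik] by simp
    fix j assume j: "b j \<noteq> 0"
    show "j = i \<or> index_less l R j i"
    proof (cases "fst j \<le> k")
      case True
      then show ?thesis using i(2) j eq by simp
    next
      case False
      then show ?thesis using ik by (auto simp: index_less_def split: prod.splits)
    qed
  qed
qed

text \<open>
  Let \<open>k\<close> be the first stage where \<open>w\<close> has nonzero flow. Then \<open>w\<close> is trivial at all stages up to \<open>k\<close>, so its
  linear part fixes the coordinates of these stages and \<open>w\<close> acts on them as translation by the cocycle.
  These coordinates dominate, so every point moves in the direction given by the sign of the cocycle.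
\<close>
lemma moves_one_way:
  assumes w: "soluble_class d w \<noteq> soluble_class d []"
  defines "f \<equiv> \<lambda>m i. shift d w m i + cocycle d w i"
  shows "(\<forall>m\<in>carrier L. f m \<noteq> m \<and> (m, f m) \<in> lex_order) \<or>
         (\<forall>m\<in>carrier L. f m \<noteq> m \<and> (f m, m) \<in> lex_order)"
proof -
  obtain k where k: "k < d" "tower.flow k w \<noteq> (\<lambda>_. 0)"
    and least: "\<And>j. j < k \<Longrightarrow> tower.flow j w = (\<lambda>_. 0)"
  proof -
    from w have "\<exists>k. k < d \<and> tower.flow k w \<noteq> (\<lambda>_. 0)"
      by (auto simp: soluble_class_eq_iff fun_eq_iff)
    then obtain k where "k < d \<and> tower.flow k w \<noteq> (\<lambda>_. 0)"
      "\<forall>j<k. \<not> (j < d \<and> tower.flow j w \<noteq> (\<lambda>_. 0))"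
      unfolding exists_least_iff[of "\<lambda>k. k < d \<and> tower.flow k w \<noteq> (\<lambda>_. 0)"] by blast
    then show ?thesis by (intro that[of k]) (auto dest: less_trans)
  qed
  obtain x c where "tower.flow k w (x, c) \<noteq> 0" using k(2) by (auto simp: fun_eq_iff)
  then have nonzero: "cocycle d w (k, x, c) \<noteq> 0" using k(1) by (simp add: cocycle_def)
  have trivial: "soluble_class j (inv_word w) = soluble_class j []" if "j \<le> k" for j
  proof -
    have "soluble_class j w = soluble_class j []"
      using least that by (auto simp: soluble_class_eq_iff fun_eq_iff)
    from tower.cong_inv_word[OF this] show ?thesis by simp
  qed
  have top: "f m i - m i = cocycle d w i" if "m \<in> carrier L" "fst i \<le> k" for m i
    using trivial[OF that(2)] index_translate_trivial[of i d "inv_word w"] fin_supp_outside[OF that(1), of i]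
    by (simp add: f_def shift_def)
  have f_closed: "f m \<in> carrier L" if "m \<in> carrier L" for m
  proof -
    interpret comm_group L by (rule comm_group_fin_supp_group)
    show ?thesis using m_closed[OF shift_closed[OF that] cocycle_closed[of d w]] by (simp add: f_def)
  qed
  have moved: "f m \<noteq> m" if "m \<in> carrier L" for m
    using top[OF that, of "(k, x, c)"] nonzero by auto
  have "cocycle d w \<noteq> (\<lambda>_. 0)" using nonzero by auto
  from lead_pos_cases[OF cocycle_closed this] show ?thesis
  proof
    assume up: "lead_pos (index_less l R) (cocycle d w)"
    have "lead_pos (index_less l R) (\<lambda>i. f m i - m i)" if "m \<in> carrier L" for m
      by (rule lead_pos_if_eq_on_top_levels[OF up _ nonzero, of k]) (simp_all add: top[OF that])
    then show ?thesis using moved f_closed by (simp add: lex_order_def)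
  next
    assume down: "lead_pos (index_less l R) (\<lambda>i. - cocycle d w i)"
    have "lead_pos (index_less l R) (\<lambda>i. m i - f m i)" if "m \<in> carrier L" for m
    proof (rule lead_pos_if_eq_on_top_levels[OF down])
      show "m i - f m i = - cocycle d w i" if "fst i \<le> k" for i
        using top[OF \<open>m \<in> carrier L\<close> that] by simp
      show "- cocycle d w (k, x, c) \<noteq> 0" using nonzero by simp
    qed simp
    then show ?thesis using moved f_closed by (simp add: lex_order_def)
  qed
qed

end

lemma exists_strict_linear_order:
  "\<exists>l :: 'a \<Rightarrow> 'a \<Rightarrow> bool. transp_on UNIV l \<and> asymp_on UNIV l \<and> totalp_on UNIV l"
proof -
  obtain r :: "'a rel" where "well_order_on UNIV r" using well_order_on by blast
  then have r: "trans r" "antisym r" "total_on UNIV r" by (auto simp: order_on_defs)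
  let ?l = "\<lambda>x y. (x, y) \<in> r \<and> x \<noteq> y"
  have "transp_on UNIV ?l" using r(1,2) by (intro transp_onI) (auto dest: transD antisymD)
  moreover have "asymp_on UNIV ?l" using r(2) by (intro asymp_onI) (auto dest: antisymD)
  moreover have "totalp_on UNIV ?l" using r(3) by (intro totalp_onI) (auto simp: total_on_def)
  ultimately show ?thesis by blast
qed

text \<open>
  Orders on the earlier stages order the edges, hence the functions on edges, hence the next stage.
\<close>
lemma exists_left_invariant_order: "\<exists>r :: 'a word set \<Rightarrow> _. left_invariant_order k r"
proof (induction k rule: less_induct)
  case (less k)
  obtain l :: "'a \<Rightarrow> 'a \<Rightarrow> bool" where l: "transp_on UNIV l" "asymp_on UNIV l" "totalp_on UNIV l"
    using exists_strict_linear_order by blast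
  from less obtain R :: "nat \<Rightarrow> 'a word set \<Rightarrow> 'a word set \<Rightarrow> bool"
    where "\<And>j. j < k \<Longrightarrow> left_invariant_order j (R j)"
    by metis
  with l have "ordered_tower k l R" by unfold_locales
  from ordered_tower.left_invariant_order_pullback[OF this] show ?case by blast
qed

theorem corollary0p5:
  fixes G :: "('g, 'm) monoid_scheme" and X :: "'g set" and d :: nat
  assumes "d \<ge> 1" and "free_soluble_on d G X"
  shows "\<exists>(\<Lambda> :: 'g big monoid) r \<phi>.
           ordered_abelian_group \<Lambda> r \<and>
           affine_action G \<Lambda> r \<phi> \<and>
           orientation_preserving_action G r \<phi> \<and>
           essentially_free G \<Lambda> r \<phi>"
proof -
  interpret G: group G
    using assms(2) by (simp add: free_soluble_on_def soluble_of_length_le_def)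
  obtain l :: "'g \<Rightarrow> 'g \<Rightarrow> bool" where l: "transp_on UNIV l" "asymp_on UNIV l" "totalp_on UNIV l"
    using exists_strict_linear_order by blast
  obtain R :: "nat \<Rightarrow> 'g word set \<Rightarrow> 'g word set \<Rightarrow> bool"
    where R: "\<And>k. left_invariant_order k (R k)"
    using exists_left_invariant_order by metis
  interpret T: ordered_tower d l R by unfold_locales (rule l R)+
  interpret \<Lambda>: ordered_abelian_group T.L T.lex_order by (rule T.ordered_abelian_group_lex_order)
  obtain h where h: "h \<in> hom G (tower.quotient_group d :: 'g word set monoid)"
    and inj: "inj_on h (carrier G)"
    using free_soluble_embeds[OF assms(2)] .
  interpret h: group_hom G "tower.quotient_group d :: 'g word set monoid" h
    using h by (simp add: group_hom_def group_hom_axioms_def G.group_axioms tower.group_quotient_group)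
  define w where "w g = tower.rep d (h g)" for g
  have rep_class: "soluble_class d (w g) = h g" if "g \<in> carrier G" for g
    using hom_in_carrier[OF h that] by (simp add: w_def)
  have class_mult: "soluble_class d (w (g \<otimes>\<^bsub>G\<^esub> g')) = soluble_class d (w g @ w g')"
    if "g \<in> carrier G" "g' \<in> carrier G" for g g'
  proof -
    have "soluble_class d (w (g \<otimes>\<^bsub>G\<^esub> g')) = h g \<otimes>\<^bsub>tower.quotient_group d\<^esub> h g'"
      using that by (simp only: rep_class G.m_closed h.hom_mult)
    then show ?thesis using that by (simp only: rep_class[symmetric] tower.mult_quotient_group)
  qed
  have class_one: "soluble_class d (w \<one>\<^bsub>G\<^esub>) = soluble_class d []"
    using rep_class[of "\<one>\<^bsub>G\<^esub>"] h.hom_one by simp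
  define \<phi> where
    "\<phi> = (\<lambda>g. \<lambda>m\<in>carrier T.L. shift d (w g) m \<otimes>\<^bsub>T.L\<^esub> cocycle d (w g))"
  have action: "affine_action G T.L T.lex_order \<phi> \<and> orientation_preserving_action G T.lex_order \<phi>"
    unfolding \<phi>_def
  proof (rule \<Lambda>.affine_action_of_cocycle[OF G.group_axioms])
    fix g g' m m'
    assume g: "g \<in> carrier G" "g' \<in> carrier G"
    show "cocycle d (w (g \<otimes>\<^bsub>G\<^esub> g')) =
        cocycle d (w g) \<otimes>\<^bsub>T.L\<^esub> shift d (w g) (cocycle d (w g'))"
      using class_mult[OF g] by (simp add: cocycle_append flip: cocycle_eq_iff)
    show "shift d (w (g \<otimes>\<^bsub>G\<^esub> g')) m = shift d (w g) (shift d (w g') m)"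
      using shift_cong[OF class_mult[OF g]] by (simp add: shift_append)
  next
    fix m assume "m \<in> carrier T.L"
    then show "shift d (w \<one>\<^bsub>G\<^esub>) m = m"
      using shift_cong[OF class_one] by (simp add: shift_Nil)
  next
    fix g m m' assume "(m, m') \<in> T.lex_order"
    then have m: "m \<in> carrier T.L" "m' \<in> carrier T.L"
      "m = m' \<or> lead_pos (index_less l R) (\<lambda>i. m' i - m i)"
      by (auto simp: T.lex_order_def)
    have "shift d (w g) (\<lambda>i. m' i - m i) = (\<lambda>i. shift d (w g) m' i - shift d (w g) m i)"
      by (auto simp: shift_def)
    then show "(shift d (w g) m, shift d (w g) m') \<in> T.lex_order"
      using m T.lead_pos_shift[OF fin_supp_diff[OF m(2,1)], of "w g"]
      by (auto simp: T.lex_order_def shift_closed)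
  qed (simp_all add: shift_closed cocycle_closed, auto simp: shift_def)
  have "essentially_free G T.L T.lex_order \<phi>"
    unfolding essentially_free_def
  proof (intro ballI impI)
    fix g assume g: "g \<in> carrier G" "g \<noteq> \<one>\<^bsub>G\<^esub>"
    then have "soluble_class d (w g) \<noteq> soluble_class d []"
      using inj_onD[OF inj _ g(1) G.one_closed] rep_class[OF g(1)] h.hom_one by auto
    from T.moves_one_way[OF this]
    have "(\<forall>m\<in>carrier T.L. \<phi> g m \<noteq> m \<and> (m, \<phi> g m) \<in> T.lex_order) \<or>
        (\<forall>m\<in>carrier T.L. \<phi> g m \<noteq> m \<and> (\<phi> g m, m) \<in> T.lex_order)"
      by (simp add: \<phi>_def)
    moreover have "bij_betw (\<phi> g) (carrier T.L) (carrier T.L)"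
      using action group_action.bij_prop0[of G "carrier T.L" \<phi> g] g(1)
      by (auto simp: affine_action_def alpha_affine_action_def Bij_def)
    ultimately show "rigid T.L T.lex_order (\<phi> g) \<and> hyperbolic T.L (\<phi> g)"
      using \<Lambda>.rigid_hyperbolic_if_moves_one_way by blast
  qed
  with action \<Lambda>.ordered_abelian_group_axioms show ?thesis by blast
qed

end
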